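(* Let $n>1$ be an odd integer and let $M$ be either $(n+1)/2$ or $n-1$. Then, modulo $\Phi_n(q)(1-aq^n)(a-q^n)$, \begin{align*} &\sum_{k=0}^{M}[4k-1]\frac{(aq^{-1},q^{-1}/a,q^{-1}/b,cq^{-1},dq^{-1},q^{-1};q^2)_k}{(q^{2}/a,aq^2,bq^2,q^2/c,q^{2}/d,q^2;q^2)_k}\bigg(\frac{bq^7}{cd}\bigg)^k\\ &\equiv[n](bq)^{(n+1)/2}\frac{(q^{-2}/b;q^2)_{(n+1)/2}}{(bq^2;q^2)_{(n+1)/2}} \sum_{k=0}^{(n+1)/2}\frac{(aq^{-1},q^{-1}/a,q^{-1}/b,q^3/cd;q^2)_k}{(q^2,q^{-2}/b,q^2/c,q^2/d;q^2)_k}q^{2k}. \end{align*}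
   Context: Here $q,a,b,c,d$ are indeterminates. The $q$-shifted factorial is $(x;q)_0=1$, $(x;q)_k=(1-x)(1-xq)\cdots(1-xq^{k-1})$ for $k\ge1$, and $(x_1,\dots,x_m;q)_k=(x_1;q)_k\cdots(x_m;q)_k$. The $q$-integer is $[m]=(1-q^m)/(1-q)$, and $\Phi_n(q)$ is the $n$-th cyclotomic polynomial in $q$. A congruence $A\equiv B$ modulo a polynomial $P$ between rational functions means that $A-B$ is a rational function whose numerator is divisible by $P$ and whose denominator is coprime to $P$. *)

theory Defs
  imports Complex_Main "HOL-Computational_Algebra.Computational_Algebra"
begin

text \<open>Integer polynomials in the five indeterminates q, a, b, c, d, realised as nested
  univariate polynomials: the innermost variable is q, then a, b, c, and the outermost is d.\<close>
type_synonym mpoly = "int poly poly poly poly poly"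

type_synonym rfun = "mpoly fract"

definition Xq :: mpoly where "Xq = [:[:[:[:[:0, 1:]:]:]:]:]"
definition Xa :: mpoly where "Xa = [:[:[:[:0, 1:]:]:]:]"
definition Xb :: mpoly where "Xb = [:[:[:0, 1:]:]:]"
definition Xc :: mpoly where "Xc = [:[:0, 1:]:]"
definition Xd :: mpoly where "Xd = [:0, 1:]"

definition cyclotomic_complex :: "nat \<Rightarrow> complex poly" where
  "cyclotomic_complex n =
     (\<Prod>k\<in>{k\<in>{1..n}. coprime k n}. [:- cis (2 * pi * real k / real n), 1:])"

definition cyclotomic :: "nat \<Rightarrow> int poly" where
  "cyclotomic n = (THE p. map_poly of_int p = cyclotomic_complex n)"

definition eval_at_q :: "int poly \<Rightarrow> mpoly" where
  "eval_at_q p = (\<Sum>i\<le>degree p. of_int (coeff p i) * Xq ^ i)"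

definition Phi :: "nat \<Rightarrow> mpoly" where
  "Phi n = eval_at_q (cyclotomic n)"

definition qpoch :: "'a::comm_ring_1 \<Rightarrow> 'a \<Rightarrow> nat \<Rightarrow> 'a" where
  "qpoch x p k = (\<Prod>j<k. 1 - x * p ^ j)"

definition qpochs :: "'a::comm_ring_1 list \<Rightarrow> 'a \<Rightarrow> nat \<Rightarrow> 'a" where
  "qpochs xs p k = prod_list (map (\<lambda>x. qpoch x p k) xs)"

definition qint :: "'a::field \<Rightarrow> int \<Rightarrow> 'a" where
  "qint q m = (1 - q powi m) / (1 - q)"

definition cong_rf :: "rfun \<Rightarrow> rfun \<Rightarrow> mpoly \<Rightarrow> bool" where
  "cong_rf A B P \<longleftrightarrow>
     (\<exists>N D. D \<noteq> 0 \<and> P dvd N \<and> coprime D P \<and> A - B = to_fract N / to_fract D)"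

end

theory Submission
  imports Defs
begin

text \<open>
  Modulo \<open>1 - a q^n\<close> or \<open>a - q^n\<close> the congruence is an identity: for \<open>a = q^n\<close> or \<open>a = q^(-n)\<close> the
  left-hand sum stops at \<open>(n + 1) / 2\<close> and Watson's transformation of a terminating very-well-poised
  8-phi-7 series (base \<open>q^2\<close>) turns it into the right-hand side. Modulo \<open>Phi n\<close> both sides vanish:
  the factor \<open>[n]\<close> does so on the right, and on the left, for \<open>q\<close> a primitive \<open>n\<close>-th root of unity,
  the terms \<open>k\<close> and \<open>(n + 1) / 2 - k\<close> cancel and the terms beyond \<open>(n + 1) / 2\<close> are zero.

  Write the difference of the two sides in lowest terms as \<open>N / D\<close>. Whenever it specializes to \<open>0\<close>
  without a vanishing denominator, \<open>N\<close> vanishes and \<open>D\<close> does not. Applied to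
  \<open>a = q^n\<close>, to \<open>a = q^(-n)\<close> and to all primitive \<open>n\<close>-th roots of unity \<open>q\<close>, this gives
  divisibility of \<open>N\<close> by, and coprimality of \<open>D\<close> to, the three factors of the modulus;
  irreducibility of the cyclotomic polynomial is not needed.
\<close>

section \<open>Terminating basic hypergeometric sums\<close>

lemma qpoch_0 [simp]: "qpoch x p 0 = 1"
  by (simp add: qpoch_def)

lemma qpoch_Suc: "qpoch x p (Suc k) = qpoch x p k * (1 - x * p ^ k)"
  by (simp add: qpoch_def)

lemma qpoch_add: "qpoch x p (m + k) = qpoch x p m * qpoch (x * p ^ m) p k"
  by (induction k) (simp_all add: qpoch_Suc power_add mult.assoc)

lemma qpoch_nonzero:
  fixes x p :: "'a::idom"
  shows "(\<And>j. j < k \<Longrightarrow> x * p ^ j \<noteq> 1) \<Longrightarrow> qpoch x p k \<noteq> 0"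
  by (auto simp: qpoch_def)

text \<open>Creative telescoping: \<open>t\<close> and \<open>u\<close> are the summands of two
  consecutive sums and \<open>G\<close> is the certificate. The upper boundary value of
  \<open>G\<close> cancels the one extra term \<open>t (Suc n)\<close> of the longer sum.\<close>

lemma sum_telescoping_recurrence:
  fixes t u G :: "nat \<Rightarrow> 'a::field"
  assumes "\<And>k. k \<le> n \<Longrightarrow> a * t k - b * u k = G (Suc k) - G k"
    and "G 0 = 0" and "G (Suc n) = - (a * t (Suc n))" and "a \<noteq> 0"
  shows "(\<Sum>k\<le>Suc n. t k) = b / a * (\<Sum>k\<le>n. u k)"
proof -
  have "a * (\<Sum>k\<le>n. t k) - b * (\<Sum>k\<le>n. u k) = (\<Sum>k\<le>n. G (Suc k) - G k)"
    using assms(1) by (simp add: sum_distrib_left flip: sum_subtractf)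
  also have "\<dots> = - (a * t (Suc n))"
    using sum_lessThan_telescope[of G "Suc n"] assms(2,3)
    by (simp add: lessThan_Suc_atMost del: lessThan_Suc)
  finally have "a * (\<Sum>k\<le>Suc n. t k) = b * (\<Sum>k\<le>n. u k)"
    by (simp add: algebra_simps)
  then show ?thesis using assms(4) by (simp add: field_simps)
qed

section \<open>The q-Saalschuetz sum\<close>

context
  fixes p A B x :: "'a::field"
  assumes p: "\<And>j. p ^ Suc j \<noteq> 1"
    and C: "\<And>j. x * A * B * p ^ j \<noteq> 1"
begin

private definition t where
  "t n k = qpoch A p k * qpoch B p k / (qpoch p p k * qpoch (x * A * B) p k) * x ^ k
     * (qpoch x p (n - k) / qpoch p p (n - k))"

text \<open>\<open>G\<close> is the companion of \<open>t\<close> in a Wilf--Zeilberger pair. It carries the factor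
  \<open>- p ^ (n - j)\<close>, which is forced by the recurrence at \<open>k = 0\<close> and at \<open>k = Suc n\<close>.\<close>

private definition G where
  "G n k = (case k of 0 \<Rightarrow> 0 | Suc j \<Rightarrow> - (p ^ (n - j)) * qpoch A p k * qpoch B p k
     / (qpoch p p j * qpoch (x * A * B) p j) * x ^ k * (qpoch x p (n - j) / qpoch p p (n - j)))"

text \<open>All four terms are multiples of one hypergeometric factor; after it is taken out, a
  polynomial identity remains. The case \<open>k = 0\<close> stands apart because \<open>G\<close>
  is defined through the predecessor of \<open>k\<close>.\<close>

private lemma Saalschuetz_telescope:
  assumes "k \<le> n"
  shows "(1 - x * A * B * p ^ n) * (1 - p ^ Suc n) * t (Suc n) k
    - (1 - x * A * p ^ n) * (1 - x * B * p ^ n) * t n k = G n (Suc k) - G n k"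
proof -
  obtain m where n: "n = m + k" using assms by (metis le_add_diff_inverse2)
  \<comment> \<open>Of the denominators \<open>qpoch p p m\<close> and
    \<open>qpoch p p (Suc m)\<close> that occur, the larger one is taken, so that every term is a
    polynomial multiple of \<open>F\<close>.\<close>
  define F where "F = qpoch A p k * qpoch B p k / (qpoch p p k * qpoch (x * A * B) p k) * x ^ k
     * (qpoch x p m / qpoch p p (Suc m))"
  have p1: "1 - p ^ Suc m \<noteq> 0" using p[of m] by simp
  have t0: "t n k = F * (1 - p ^ Suc m)"
    using p1 by (simp add: t_def F_def n qpoch_Suc mult_ac)
  have t1: "t (Suc n) k = F * (1 - x * p ^ m)"
    by (simp add: t_def F_def n qpoch_Suc Suc_diff_le)
  have G1: "G n (Suc k) = F * (- (p ^ m) * x * (1 - A * p ^ k) * (1 - B * p ^ k) * (1 - p ^ Suc m))"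
    using p1 by (simp add: G_def F_def n qpoch_Suc mult_ac)
  show ?thesis
  proof (cases k)
    case 0
    then have "G n k = 0" by (simp add: G_def)
    then show ?thesis unfolding t0 t1 G1 using 0 n by (simp add: algebra_simps)
  next
    case (Suc j)
    have e: "n - j = Suc m" using Suc n by simp
    have "1 - p ^ k \<noteq> 0" "1 - x * A * B * p ^ j \<noteq> 0" using p[of j] C[of j] Suc by auto
    then have G0: "G n k = F * (- (p ^ Suc m) * (1 - p ^ k) * (1 - x * A * B * p ^ j) * (1 - x * p ^ m))"
      by (simp add: G_def F_def e Suc qpoch_Suc mult_ac)
    \<comment> \<open>Naming the powers turns the claim into an identity between polynomials in
      \<open>p, x, A, B, W, J\<close>, where \<open>p ^ k = p * J\<close>.\<close>
    define W J where "W = p ^ m" and "J = p ^ j"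
    have "(1 - x * A * B * (W * (p * J))) * (1 - p * (W * (p * J))) * (1 - x * W)
      - (1 - x * A * (W * (p * J))) * (1 - x * B * (W * (p * J))) * (1 - p * W)
      = - W * x * (1 - A * (p * J)) * (1 - B * (p * J)) * (1 - p * W)
        - (- (p * W) * (1 - p * J) * (1 - x * A * B * J) * (1 - x * W))"
      by algebra
    moreover have "p ^ k = p * J" "p ^ Suc m = p * W" "p ^ n = W * (p * J)"
      "p ^ Suc n = p * (W * (p * J))" "p ^ m = W" "p ^ j = J"
      by (simp_all add: W_def J_def Suc n power_add mult_ac)
    ultimately show ?thesis unfolding t0 t1 G1 G0
      by (simp only: right_diff_distrib[of F, symmetric] mult.assoc mult.left_commute[of _ F])
  qed
qed

text \<open>Induction on \<open>n\<close> by the telescoped first-order recurrence. In the usual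
  notation with \<open>c = x * A * B\<close>, the quotient \<open>(x;p)_(n-k) / (p;p)_(n-k)\<close>
  stands for \<open>(p^(-n);p)_k / (p^(1-n)/x;p)_k\<close> up to normalization, which avoids
  negative powers of \<open>p\<close>.\<close>

lemma q_Saalschuetz:
  "(\<Sum>k\<le>n. qpoch A p k * qpoch B p k / (qpoch p p k * qpoch (x * A * B) p k) * x ^ k
     * (qpoch x p (n - k) / qpoch p p (n - k)))
   = qpoch (x * A) p n * qpoch (x * B) p n / (qpoch p p n * qpoch (x * A * B) p n)"
proof -
  have "(\<Sum>k\<le>n. t n k) = qpoch (x * A) p n * qpoch (x * B) p n / (qpoch p p n * qpoch (x * A * B) p n)"
  proof (induction n)
    case 0
    show ?case by (simp add: t_def)
  next
    case (Suc n)
    let ?a = "(1 - x * A * B * p ^ n) * (1 - p ^ Suc n)"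
    let ?b = "(1 - x * A * p ^ n) * (1 - x * B * p ^ n)"
    have nz: "?a \<noteq> 0" using p[of n] C[of n] by simp
    have "(\<Sum>k\<le>Suc n. t (Suc n) k) = ?b / ?a * (\<Sum>k\<le>n. t n k)"
    proof (rule sum_telescoping_recurrence)
      show "G n (Suc n) = - (?a * t (Suc n) (Suc n))"
        using nz by (simp add: G_def t_def qpoch_Suc)
    qed (use nz Saalschuetz_telescope in \<open>auto simp: G_def[of n 0]\<close>)
    then show ?case unfolding Suc.IH by (simp add: qpoch_Suc mult_ac)
  qed
  then show ?thesis by (simp add: t_def)
qed

end

section \<open>The terminating very-well-poised 6-phi-5 sum\<close>

text \<open>The part of a very-well-poised summand that does not depend on the length of the sum.
  The product at the end is the usual \<open>(- y) ^ r * p ^ (r choose 2)\<close>.\<close>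

definition well_poised :: "'a::field \<Rightarrow> 'a \<Rightarrow> 'a \<Rightarrow> 'a \<Rightarrow> 'a \<Rightarrow> nat \<Rightarrow> 'a" where
  "well_poised p y A B C r = (1 - A * p ^ (2 * r)) * qpoch A p r * qpoch B p r * qpoch C p r
     / (qpoch p p r * qpoch (y * B) p r * qpoch (y * C) p r) * (\<Prod>j<r. - (y * p ^ j))"

context
  fixes p y A B C :: "'a::field"
  assumes p: "\<And>j. p ^ Suc j \<noteq> 1"
    and A: "\<And>j. A * p ^ j \<noteq> 1"
    and yB: "\<And>j. y * B * p ^ j \<noteq> 1"
    and yC: "\<And>j. y * C * p ^ j \<noteq> 1"
    and Ap: "A * p = y * B * C"
begin

private definition T where
  "T k r = well_poised p y A B C r / (qpoch p p (k - r) * qpoch A p (Suc (k + r)))"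

text \<open>The certificate for \<open>T\<close>: it vanishes at \<open>r = 0\<close>, and at
  \<open>r = Suc k\<close> it cancels the extra top term.\<close>

private definition H where
  "H k r = (case r of 0 \<Rightarrow> 0 | Suc j \<Rightarrow> - (p ^ (k - j)) * qpoch A p r * qpoch B p r * qpoch C p r
     / (qpoch p p j * qpoch (y * B) p j * qpoch (y * C) p j) * (\<Prod>j<r. - (y * p ^ j))
     / (qpoch p p (k - j) * qpoch A p (Suc (k + r))))"

text \<open>As for q-Saalschuetz, everything is a multiple of one factor \<open>F\<close>. The
  remaining polynomial identity holds modulo the relation \<open>A * p = y * B * C\<close>.\<close>

private lemma Rogers_telescope:
  assumes "r \<le> k"
  shows "(1 - p ^ Suc k) * (1 - y * B * p ^ k) * (1 - y * C * p ^ k) * T (Suc k) r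
    - (1 - y * p ^ k) * T k r = H k (Suc r) - H k r"
proof -
  obtain m where k: "k = m + r" using assms by (metis le_add_diff_inverse2)
  define F where "F = qpoch A p r * qpoch B p r * qpoch C p r
     / (qpoch p p r * qpoch (y * B) p r * qpoch (y * C) p r) * (\<Prod>j<r. - (y * p ^ j))
     / (qpoch p p (Suc m) * qpoch A p (m + 2 * r + 2))"
  have p1: "1 - p ^ Suc m \<noteq> 0" using p[of m] by simp
  have A1: "1 - A * p ^ (m + 2 * r + 1) \<noteq> 0" using A[of "m + 2 * r + 1"] by simp
  have A2: "qpoch A p (m + 2 * r + 2) = qpoch A p (m + 2 * r + 1) * (1 - A * p ^ (m + 2 * r + 1))"
    using qpoch_Suc[of A p "m + 2 * r + 1"] by simp
  have e: "Suc (k + r) = m + 2 * r + 1" "Suc (Suc k + r) = m + 2 * r + 2" "Suc (k + Suc r) = m + 2 * r + 2"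
    "k - r = m" "Suc k - r = Suc m"
    using k by auto
  have t0: "T k r = F * ((1 - A * p ^ (2 * r)) * (1 - p ^ Suc m) * (1 - A * p ^ (m + 2 * r + 1)))"
    unfolding T_def e well_poised_def F_def A2 qpoch_Suc[of p p m] using p1 A1 by (simp add: mult_ac)
  have t1: "T (Suc k) r = F * (1 - A * p ^ (2 * r))"
    unfolding T_def e well_poised_def F_def by (simp add: mult_ac)
  have G1: "H k (Suc r) = F * (p ^ m * (1 - A * p ^ r) * (1 - B * p ^ r) * (1 - C * p ^ r)
      * (y * p ^ r) * (1 - p ^ Suc m))"
    unfolding H_def nat.case e F_def qpoch_Suc[of p p m] qpoch_Suc[of _ p r] prod.lessThan_Suc
    using p1 by (simp add: mult_ac)
  define W where "W = p ^ m"
  show ?thesis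
  proof (cases r)
    case 0
    have "H k r = 0" by (simp add: H_def 0)
    moreover have "(1 - p * W) * (1 - y * B * W) * (1 - y * C * W) * (1 - A)
      - (1 - y * W) * ((1 - A) * (1 - p * W) * (1 - A * (W * p)))
      = W * (1 - A) * (1 - B) * (1 - C) * y * (1 - p * W)"
      using Ap by algebra
    then have "F * ((1 - p * W) * (1 - y * B * W) * (1 - y * C * W) * (1 - A)
      - (1 - y * W) * ((1 - A) * (1 - p * W) * (1 - A * (W * p))))
      = F * (W * (1 - A) * (1 - B) * (1 - C) * y * (1 - p * W))"
      by simp
    ultimately show ?thesis unfolding t0 t1 G1 using 0 k
      by (simp add: W_def algebra_simps)
  next
    case (Suc j)
    have e': "k - j = Suc m" using Suc k by simp
    have nzs: "1 - p ^ r \<noteq> 0" "1 - y * B * p ^ j \<noteq> 0" "1 - y * C * p ^ j \<noteq> 0"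
      using p[of j] yB[of j] yC[of j] Suc by auto
    have r1: "qpoch p p r = qpoch p p j * (1 - p ^ r)"
      "qpoch (y * B) p r = qpoch (y * B) p j * (1 - y * B * p ^ j)"
      "qpoch (y * C) p r = qpoch (y * C) p j * (1 - y * C * p ^ j)"
      by (simp_all add: Suc qpoch_Suc)
    have "H k r = - (p ^ Suc m) * qpoch A p r * qpoch B p r * qpoch C p r
       / (qpoch p p j * qpoch (y * B) p j * qpoch (y * C) p j) * (\<Prod>j<r. - (y * p ^ j))
       / (qpoch p p (Suc m) * qpoch A p (m + 2 * r + 1))"
      by (simp add: H_def Suc e'[unfolded Suc] k mult_2 add_ac)
    then have G0: "H k r = F * (- (p ^ Suc m) * (1 - p ^ r) * (1 - y * B * p ^ j) * (1 - y * C * p ^ j)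
       * (1 - A * p ^ (m + 2 * r + 1)))"
      unfolding F_def r1 A2 using nzs A1 by (simp add: mult_ac)
    define J where "J = p ^ j"
    have "(1 - p * (W * (p * J))) * (1 - y * B * (W * (p * J))) * (1 - y * C * (W * (p * J)))
        * (1 - A * (p * J)^2)
      - (1 - y * (W * (p * J))) * ((1 - A * (p * J)^2) * (1 - p * W) * (1 - A * (W * (p * J)^2 * p)))
      = W * (1 - A * (p * J)) * (1 - B * (p * J)) * (1 - C * (p * J)) * (y * (p * J)) * (1 - p * W)
      - (- (p * W) * (1 - p * J) * (1 - y * B * J) * (1 - y * C * J) * (1 - A * (W * (p * J)^2 * p)))"
      using Ap by algebra
    moreover have "p ^ r = p * J" "p ^ Suc m = p * W" "p ^ k = W * (p * J)" "p ^ (2 * r) = (p * J)^2"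
      "p ^ Suc k = p * (W * (p * J))"
      "p ^ (m + 2 * r + 1) = W * (p * J)^2 * p" "p ^ m = W" "p ^ j = J"
      by (simp_all add: W_def J_def Suc k power_add power_mult power2_eq_square power_mult_distrib mult_ac)
    ultimately show ?thesis unfolding t0 t1 G1 G0
      by (simp only: right_diff_distrib[of F, symmetric] mult.assoc mult.left_commute[of _ F])
  qed
qed

text \<open>With \<open>y = A * p / (B * C)\<close>, the denominators \<open>y * B\<close> and
  \<open>y * C\<close> are the well-poised partners of \<open>C\<close> and \<open>B\<close>. The
  weight \<open>1 / ((p;p)_(k-r) (A;p)_(k+r+1))\<close> is the kernel of a Bailey pair relative to
  \<open>A\<close>, up to the constant \<open>1 - A\<close>.\<close>

lemma q_Rogers_6phi5:
  "(\<Sum>r\<le>k. well_poised p y A B C r / (qpoch p p (k - r) * qpoch A p (Suc (k + r))))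
   = qpoch y p k / (qpoch p p k * qpoch (y * B) p k * qpoch (y * C) p k)"
proof -
  have "(\<Sum>r\<le>k. T k r) = qpoch y p k / (qpoch p p k * qpoch (y * B) p k * qpoch (y * C) p k)"
  proof (induction k)
    case 0
    show ?case using A[of 0] by (simp add: T_def well_poised_def qpoch_Suc)
  next
    case (Suc k)
    let ?a = "(1 - p ^ Suc k) * (1 - y * B * p ^ k) * (1 - y * C * p ^ k)"
    let ?b = "1 - y * p ^ k"
    have nz: "?a \<noteq> 0" using p[of k] yB[of k] yC[of k] by simp
    \<comment> \<open>This is the last factor of \<open>qpoch A p (Suc (2 * Suc k))\<close>; in the
      top term it cancels against the very-well-poised factor of the numerator.\<close>
    have nA: "1 - A * p ^ (2 * Suc k) \<noteq> 0" using A[of "2 * Suc k"] by simp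
    have e: "Suc (Suc k + Suc k) = Suc (2 * Suc k)" "Suc (k + Suc k) = 2 * Suc k" by simp_all
    have "(\<Sum>r\<le>Suc k. T (Suc k) r) = ?b / ?a * (\<Sum>r\<le>k. T k r)"
    proof (rule sum_telescoping_recurrence)
      show "H k (Suc k) = - (?a * T (Suc k) (Suc k))"
        unfolding T_def H_def nat.case well_poised_def e qpoch_Suc[of A p "2 * Suc k"]
          qpoch_Suc[of p p k] qpoch_Suc[of "y * B" p k] qpoch_Suc[of "y * C" p k]
        using nz nA by (simp add: mult_ac)
    qed (use nz Rogers_telescope in \<open>auto simp: H_def[of k 0]\<close>)
    then show ?case unfolding Suc.IH by (simp add: qpoch_Suc mult_ac)
  qed
  then show ?thesis by (simp add: T_def)
qed

end

section \<open>Watson's transformation\<close>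

lemma q_Watson:
  fixes p x y A B C D E :: "'a::field"
  assumes p: "\<And>j. p ^ Suc j \<noteq> 1"
    and A: "\<And>j. A * p ^ j \<noteq> 1"
    and yB: "\<And>j. y * B * p ^ j \<noteq> 1"
    and yC: "\<And>j. y * C * p ^ j \<noteq> 1"
    and xD: "\<And>j. x * D * p ^ j \<noteq> 1"
    and xE: "\<And>j. x * E * p ^ j \<noteq> 1"
    and yBC: "A * p = y * B * C" and xDE: "A * p = x * D * E"
  shows "(\<Sum>k\<le>N. qpoch D p k * qpoch E p k * x ^ k * (qpoch x p (N - k) / qpoch p p (N - k))
      * (qpoch y p k / (qpoch p p k * qpoch (y * B) p k * qpoch (y * C) p k)))
    = qpoch (x * D) p N * qpoch (x * E) p N
      * (\<Sum>r\<le>N. well_poised p y A B C r * qpoch D p r * qpoch E p r * x ^ r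
          / (qpoch (x * D) p r * qpoch (x * E) p r * qpoch p p (N - r) * qpoch A p (Suc (N + r))))"
proof -
  \<comment> \<open>Bailey's argument: expand the balanced factor by the 6-phi-5 sum, swap the two sums, and
    evaluate the inner one by the q-Saalschuetz sum.\<close>
  define w where "w k = qpoch D p k * qpoch E p k * x ^ k * (qpoch x p (N - k) / qpoch p p (N - k))" for k
  \<comment> \<open>The second index is \<open>s = k - r\<close>, so that the double sum runs over
    the triangle \<open>r + s \<le> N\<close>.\<close>
  define f where "f r s = w (r + s) * (well_poised p y A B C r / (qpoch p p s * qpoch A p (Suc (2 * r + s))))"
    for r s
  have nz: "qpoch A p k \<noteq> 0" "qpoch (x * D) p k \<noteq> 0" "qpoch (x * E) p k \<noteq> 0" for k
    using A xD xE by (auto intro!: qpoch_nonzero)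
  have inner: "(\<Sum>s\<le>N - r. f r s) = qpoch (x * D) p N * qpoch (x * E) p N
      * (well_poised p y A B C r * qpoch D p r * qpoch E p r * x ^ r
          / (qpoch (x * D) p r * qpoch (x * E) p r * qpoch p p (N - r) * qpoch A p (Suc (N + r))))"
    if "r \<le> N" for r
  proof -
    define m where "m = N - r"
    have N: "N = r + m" using that m_def by simp
    \<comment> \<open>By \<open>xDE\<close>, shifting \<open>D\<close> and \<open>E\<close> by
      \<open>p ^ r\<close> yields exactly the parameter of the tail of \<open>qpoch A p\<close>, as
      the q-Saalschuetz sum requires.\<close>
    have C': "x * (D * p ^ r) * (E * p ^ r) = A * p ^ Suc (2 * r)"
    proof -
      have "x * (D * p ^ r) * (E * p ^ r) = (x * D * E) * p ^ (2 * r)"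
        by (simp add: power_mult power2_eq_square power_mult_distrib mult_ac)
      then show ?thesis unfolding xDE[symmetric] by (simp add: mult_ac)
    qed
    let ?c = "well_poised p y A B C r * qpoch D p r * qpoch E p r * x ^ r / qpoch A p (Suc (2 * r))"
    have A2: "qpoch A p (Suc (2 * r + s)) = qpoch A p (Suc (2 * r)) * qpoch (A * p ^ Suc (2 * r)) p s" for s
      using qpoch_add[of A p "Suc (2 * r)" s] by simp
    have "(\<Sum>s\<le>m. f r s) = (\<Sum>s\<le>m. ?c * (qpoch (D * p ^ r) p s * qpoch (E * p ^ r) p s
         / (qpoch p p s * qpoch (x * (D * p ^ r) * (E * p ^ r)) p s) * x ^ s
         * (qpoch x p (m - s) / qpoch p p (m - s))))"
      unfolding f_def w_def A2 C' qpoch_add power_add N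
      by (intro sum.cong refl) (simp add: mult_ac)
    also have "\<dots> = ?c * (qpoch (x * (D * p ^ r)) p m * qpoch (x * (E * p ^ r)) p m
        / (qpoch p p m * qpoch (x * (D * p ^ r) * (E * p ^ r)) p m))"
      unfolding sum_distrib_left[symmetric]
    proof (subst q_Saalschuetz)
      fix j show "p ^ Suc j \<noteq> 1" by (rule p)
      show "x * (D * p ^ r) * (E * p ^ r) * p ^ j \<noteq> 1"
        unfolding C' using A[of "Suc (2 * r) + j"] by (simp add: power_add mult_ac)
    qed simp
    also have "x * (D * p ^ r) = x * D * p ^ r" by (simp add: mult_ac)
    also have "x * (E * p ^ r) = x * E * p ^ r" by (simp add: mult_ac)
    also have "x * D * p ^ r * (E * p ^ r) = A * p ^ Suc (2 * r)" using C' by (simp add: mult_ac)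
    also have "qpoch (x * D * p ^ r) p m = qpoch (x * D) p N / qpoch (x * D) p r"
      using nz by (simp add: N qpoch_add)
    also have "qpoch (x * E * p ^ r) p m = qpoch (x * E) p N / qpoch (x * E) p r"
      using nz by (simp add: N qpoch_add)
    also have "qpoch (A * p ^ Suc (2 * r)) p m = qpoch A p (Suc (N + r)) / qpoch A p (Suc (2 * r))"
      using A2[of m] nz by (simp add: N mult_2 add_ac)
    finally show ?thesis using nz by (simp add: m_def mult_ac)
  qed
  have "(\<Sum>k\<le>N. w k * (qpoch y p k / (qpoch p p k * qpoch (y * B) p k * qpoch (y * C) p k)))
    = (\<Sum>k\<le>N. w k * (\<Sum>r\<le>k. well_poised p y A B C r / (qpoch p p (k - r) * qpoch A p (Suc (k + r)))))"
    using assms by (simp add: q_Rogers_6phi5)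
  also have "\<dots> = (\<Sum>k\<le>N. \<Sum>r\<le>k. f r (k - r))"
    unfolding sum_distrib_left by (intro sum.cong refl) (auto simp: f_def mult_2 add.commute)
  also have "\<dots> = (\<Sum>(r, s)\<in>{(r, s). r + s \<le> N}. f r s)"
    by (rule sum.triangle_reindex_eq[symmetric])
  also have "{(r, s). r + s \<le> N} = Sigma {..N} (\<lambda>r. {..N - r})" by auto
  also have "(\<Sum>(r, s)\<in>Sigma {..N} (\<lambda>r. {..N - r}). f r s) = (\<Sum>r\<le>N. \<Sum>s\<le>N - r. f r s)"
    by (rule sum.Sigma[symmetric]) auto
  finally show ?thesis using inner by (simp add: w_def sum_distrib_left)
qed

text \<open>The factors are taken in reverse order: \<open>1 - z * p ^ j\<close> is
  \<open>- (z * p ^ j)\<close> times \<open>1 - w * p ^ (k - Suc j)\<close>.\<close>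

lemma qpoch_reflect:
  fixes z w p :: "'a::field"
  assumes "z * w * p ^ k = p" and "p \<noteq> 0"
  shows "qpoch z p k = (\<Prod>j<k. - (z * p ^ j)) * qpoch w p k"
proof -
  have "qpoch w p k = (\<Prod>j<k. 1 - w * p ^ (k - Suc j))"
    unfolding qpoch_def by (rule prod.nat_diff_reindex[symmetric])
  moreover have "1 - z * p ^ j = - (z * p ^ j) * (1 - w * p ^ (k - Suc j))" if "j < k" for j
  proof -
    have "p ^ k = p * (p ^ j * p ^ (k - Suc j))"
      using that by (metis Suc_diff_Suc add_diff_inverse_nat less_imp_le_nat linorder_not_less
        mult.left_commute power_Suc power_add)
    then have "p * (z * w * (p ^ j * p ^ (k - Suc j))) = p * 1"
      using assms by (simp add: mult_ac)
    then have "z * w * (p ^ j * p ^ (k - Suc j)) = 1"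
      using assms(2) by (metis mult_left_cancel)
    then show ?thesis by (simp add: algebra_simps)
  qed
  ultimately show ?thesis by (simp add: qpoch_def prod.distrib[symmetric])
qed

text \<open>The reflected symbol is \<open>qpoch (p * p ^ (N - r)) p r\<close>, which completes
  \<open>qpoch p p (N - r)\<close> to \<open>qpoch p p N\<close>.\<close>

lemma qpoch_inverse_power:
  fixes p :: "'a::field"
  assumes "p \<noteq> 0" and "r \<le> N"
  shows "qpoch (1 / p ^ N) p r * qpoch p p (N - r) * (p ^ N) ^ r
    = qpoch p p N * (\<Prod>j<r. - (p ^ j))"
proof -
  have N: "p ^ N = p ^ (N - r) * p ^ r" using assms(2) by (simp flip: power_add)
  have "qpoch (1 / p ^ N) p r = (\<Prod>j<r. - (1 / p ^ N * p ^ j)) * qpoch (p * p ^ (N - r)) p r"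
    by (rule qpoch_reflect) (use assms(1) N in simp_all)
  also have "(\<Prod>j<r. - (1 / p ^ N * p ^ j)) = (\<Prod>j<r. (1 / p ^ N) * - (p ^ j))"
    by simp
  also have "\<dots> = (1 / p ^ N) ^ r * (\<Prod>j<r. - (p ^ j))"
    by (simp only: prod.distrib prod_constant card_lessThan)
  finally show ?thesis
    using qpoch_add[of p p "N - r" r] assms by (simp add: power_one_over field_simps)
qed

text \<open>\<open>q_Watson\<close> in the standard notation of an 8-phi-7 and a balanced 4-phi-3:
  symbols of length \<open>N - r\<close> become symbols of length \<open>r\<close> with base point
  \<open>p^(-N)\<close>, and \<open>qpoch A p (Suc (N + r))\<close> is split at
  \<open>Suc N\<close>.\<close>

lemma q_Watson_8phi7:
  fixes p x y A B C D E :: "'a::field"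
  assumes p: "\<And>j. p ^ Suc j \<noteq> 1" and p0: "p \<noteq> 0" and x0: "x \<noteq> 0"
    and A: "\<And>j. A * p ^ j \<noteq> 1"
    and yB: "\<And>j. y * B * p ^ j \<noteq> 1"
    and yC: "\<And>j. y * C * p ^ j \<noteq> 1"
    and xD: "\<And>j. x * D * p ^ j \<noteq> 1"
    and xE: "\<And>j. x * E * p ^ j \<noteq> 1"
    and x: "\<And>j. x * p ^ j \<noteq> 1"
    and yBC: "A * p = y * B * C" and xDE: "A * p = x * D * E"
  shows "(\<Sum>r\<le>N. (1 - A * p ^ (2 * r))
      * (qpoch A p r * qpoch B p r * qpoch C p r * qpoch D p r * qpoch E p r * qpoch (1 / p ^ N) p r)
      / (qpoch p p r * qpoch (y * B) p r * qpoch (y * C) p r * qpoch (x * D) p r * qpoch (x * E) p r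
          * qpoch (A * p ^ Suc N) p r) * (x * y * p ^ N) ^ r)
    = qpoch A p (Suc N) * qpoch x p N / (qpoch (x * D) p N * qpoch (x * E) p N)
      * (\<Sum>k\<le>N. qpoch D p k * qpoch E p k * qpoch (1 / p ^ N) p k * qpoch y p k
          / (qpoch p p k * qpoch (y * B) p k * qpoch (y * C) p k * qpoch (p / (p ^ N * x)) p k) * p ^ k)"
    (is "?L = ?c * ?R")
proof -
  have nz: "qpoch p p k \<noteq> 0" "qpoch A p k \<noteq> 0" "qpoch x p k \<noteq> 0" "qpoch (x * D) p k \<noteq> 0"
    "qpoch (x * E) p k \<noteq> 0" for k
    using p A x xD xE by (auto intro!: qpoch_nonzero)
  define S where "S = (\<Sum>r\<le>N. well_poised p y A B C r * qpoch D p r * qpoch E p r * x ^ r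
          / (qpoch (x * D) p r * qpoch (x * E) p r * qpoch p p (N - r) * qpoch A p (Suc (N + r))))"
  define S' where "S' = (\<Sum>k\<le>N. qpoch D p k * qpoch E p k * x ^ k * (qpoch x p (N - k) / qpoch p p (N - k))
      * (qpoch y p k / (qpoch p p k * qpoch (y * B) p k * qpoch (y * C) p k)))"
  have W: "S' = qpoch (x * D) p N * qpoch (x * E) p N * S"
    unfolding S'_def S_def by (rule q_Watson) (use assms in auto)
  have L: "?L = qpoch A p (Suc N) * qpoch p p N * S"
    unfolding S_def sum_distrib_left
  proof (rule sum.cong[OF refl])
    fix r assume "r \<in> {..N}"
    then have r: "r \<le> N" by simp
    have Y: "(\<Prod>j<r. - (y * p ^ j)) = y ^ r * (\<Prod>j<r. - (p ^ j))"
    proof -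
      have "(\<Prod>j<r. - (y * p ^ j)) = (\<Prod>j<r. y * - (p ^ j))" by simp
      then show ?thesis by (simp only: prod.distrib prod_constant card_lessThan)
    qed
    have AA: "qpoch A p (Suc (N + r)) = qpoch A p (Suc N) * qpoch (A * p ^ Suc N) p r"
      using qpoch_add[of A p "Suc N" r] by simp
    have "qpoch (A * p ^ Suc N) p r \<noteq> 0" using AA nz by (metis mult_zero_right)
    moreover have "(\<Prod>j<r. - (p ^ j)) = qpoch (1 / p ^ N) p r * qpoch p p (N - r) * (p ^ N) ^ r / qpoch p p N"
      using qpoch_inverse_power[OF p0 r] nz by (simp add: field_simps)
    ultimately show "(1 - A * p ^ (2 * r))
      * (qpoch A p r * qpoch B p r * qpoch C p r * qpoch D p r * qpoch E p r * qpoch (1 / p ^ N) p r)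
      / (qpoch p p r * qpoch (y * B) p r * qpoch (y * C) p r * qpoch (x * D) p r * qpoch (x * E) p r
          * qpoch (A * p ^ Suc N) p r) * (x * y * p ^ N) ^ r =
        qpoch A p (Suc N) * qpoch p p N * (well_poised p y A B C r * qpoch D p r * qpoch E p r * x ^ r
          / (qpoch (x * D) p r * qpoch (x * E) p r * qpoch p p (N - r) * qpoch A p (Suc (N + r))))"
      unfolding well_poised_def Y AA power_mult_distrib using nz
      by (simp add: mult_ac)
  qed
  have "qpoch p p N * S' = qpoch x p N * ?R"
    unfolding S'_def sum_distrib_left
  proof (rule sum.cong[OF refl])
    fix k assume "k \<in> {..N}"
    then have k: "k \<le> N" by simp
    let ?P = "\<Prod>j<k. - (p ^ j)"
    have N: "p ^ N = p ^ (N - k) * p ^ k" using k by (simp flip: power_add)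
    \<comment> \<open>The reversal of this symbol and that of \<open>qpoch (1 / p ^ N) p k\<close>
      produce the same product \<open>?P\<close>, which cancels in the quotient.\<close>
    have "qpoch (p / (p ^ N * x)) p k
        = (\<Prod>j<k. - (p / (p ^ N * x) * p ^ j)) * qpoch (x * p ^ (N - k)) p k"
      by (rule qpoch_reflect) (use p0 x0 N in simp_all)
    also have "(\<Prod>j<k. - (p / (p ^ N * x) * p ^ j)) = (\<Prod>j<k. p / (p ^ N * x) * - (p ^ j))"
      by simp
    also have "\<dots> = (p / (p ^ N * x)) ^ k * ?P"
      by (simp only: prod.distrib prod_constant card_lessThan)
    also have "qpoch (x * p ^ (N - k)) p k = qpoch x p N / qpoch x p (N - k)"
      using qpoch_add[of x p "N - k" k] k nz by simp
    also have "(p / (p ^ N * x)) ^ k = p ^ k / ((p ^ N) ^ k * x ^ k)"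
      by (simp add: power_mult_distrib power_divide)
    finally have 1: "qpoch (p / (p ^ N * x)) p k
       = p ^ k / ((p ^ N) ^ k * x ^ k) * ?P * (qpoch x p N / qpoch x p (N - k))" .
    have 2: "qpoch (1 / p ^ N) p k = qpoch p p N * ?P / (qpoch p p (N - k) * (p ^ N) ^ k)"
      using qpoch_inverse_power[OF p0 k] nz p0 by (simp add: field_simps)
    have "?P \<noteq> 0" using p0 by simp
    then show "qpoch p p N * (qpoch D p k * qpoch E p k * x ^ k * (qpoch x p (N - k) / qpoch p p (N - k))
      * (qpoch y p k / (qpoch p p k * qpoch (y * B) p k * qpoch (y * C) p k)))
      = qpoch x p N * (qpoch D p k * qpoch E p k * qpoch (1 / p ^ N) p k * qpoch y p k
          / (qpoch p p k * qpoch (y * B) p k * qpoch (y * C) p k * qpoch (p / (p ^ N * x)) p k) * p ^ k)"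
      unfolding 1 2 using nz p0 x0 by (simp add: mult_ac del: prod_zero_iff)
  qed
  then have "?c * ?R = qpoch A p (Suc N) * (qpoch p p N * S')
    / (qpoch (x * D) p N * qpoch (x * E) p N)" by simp
  also have "\<dots> = qpoch A p (Suc N) * qpoch p p N * S"
    unfolding W using nz by simp
  finally show ?thesis unfolding L by simp
qed

section \<open>The two sides of the congruence and their equality at a = q^n\<close>

text \<open>Stated over an arbitrary field, so that one formula can be read both in the rational
  functions and in each specialization.\<close>

definition lhs_term :: "'a::field \<Rightarrow> 'a \<Rightarrow> 'a \<Rightarrow> 'a \<Rightarrow> 'a \<Rightarrow> nat \<Rightarrow> 'a" where
  "lhs_term q a b c d k = qint q (4 * int k - 1)
     * qpochs [a / q, 1 / (a * q), 1 / (b * q), c / q, d / q, 1 / q] (q^2) k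
     / qpochs [q^2 / a, a * q^2, b * q^2, q^2 / c, q^2 / d, q^2] (q^2) k
     * (b * q^7 / (c * d)) ^ k"

definition rhs_term :: "'a::field \<Rightarrow> 'a \<Rightarrow> 'a \<Rightarrow> 'a \<Rightarrow> 'a \<Rightarrow> nat \<Rightarrow> 'a" where
  "rhs_term q a b c d k = qpochs [a / q, 1 / (a * q), 1 / (b * q), q^3 / (c * d)] (q^2) k
     / qpochs [q^2, 1 / (q^2 * b), q^2 / c, q^2 / d] (q^2) k * q ^ (2 * k)"

definition rhs_factor :: "'a::field \<Rightarrow> 'a \<Rightarrow> nat \<Rightarrow> 'a" where
  "rhs_factor q b n = qint q (int n) * (b * q) ^ ((n + 1) div 2)
     * qpoch (1 / (q^2 * b)) (q^2) ((n + 1) div 2) / qpoch (b * q^2) (q^2) ((n + 1) div 2)"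

text \<open>The q-integer is the very-well-poised factor for the parameter \<open>1 / q\<close> in
  base \<open>q^2\<close>. At \<open>k = 0\<close> the exponent is negative, hence
  \<open>powi\<close> and \<open>q \<noteq> 0\<close>.\<close>

lemma qint_4k_minus_1:
  "q \<noteq> 0 \<Longrightarrow> qint q (4 * int k - 1) = (1 - 1 / q * (q^2) ^ (2 * k)) / (1 - q)"
proof -
  assume "q \<noteq> 0"
  then have "q powi (4 * int k - 1) = q powi (int (4 * k)) / q powi 1"
    by (simp add: power_int_diff)
  also have "\<dots> = 1 / q * (q^2) ^ (2 * k)"
    by (simp only: power_int_of_nat) (simp add: power_mult[symmetric])
  finally show ?thesis by (simp add: qint_def)
qed

text \<open>This symmetry, with the next one, reduces the evaluation at \<open>a = q^(-n)\<close> to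
  that at \<open>a = q^n\<close>.\<close>

lemma lhs_term_inverse: "lhs_term q (1 / a) b c d = lhs_term q a b c d"
  by (rule ext) (simp add: lhs_term_def qpochs_def mult_ac)

lemma rhs_term_inverse: "rhs_term q (1 / a) b c d = rhs_term q a b c d"
  by (rule ext) (simp add: rhs_term_def qpochs_def mult_ac)

text \<open>Watson's transformation in base \<open>p = q^2\<close> with \<open>A, B, C, D, E\<close>
  equal to \<open>1/q, c/q, d/q, a/q, 1/(b q)\<close> and \<open>N = (n + 1) / 2\<close>. Since
  \<open>p ^ N = a * q\<close>, the parameter \<open>1 / (a q)\<close> is the terminating
  \<open>p^(-N)\<close>.\<close>

lemma sum_lhs_term_at_power:
  fixes q b c d :: "'a::field"
  assumes "odd n" and "(n + 1) div 2 \<le> M"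
    and q0: "q \<noteq> 0" and q: "\<And>i j. q ^ i = q ^ j \<Longrightarrow> i = j"
    and nz: "b \<noteq> 0" "c \<noteq> 0" "d \<noteq> 0"
    and b: "\<And>i j. b * q ^ i \<noteq> q ^ j"
    and c: "\<And>i j. c * q ^ i \<noteq> q ^ j"
    and d: "\<And>i j. d * q ^ i \<noteq> q ^ j"
  shows "(\<Sum>k\<le>M. lhs_term q (q ^ n) b c d k)
    = rhs_factor q b n * (\<Sum>k\<le>(n + 1) div 2. rhs_term q (q ^ n) b c d k)"
proof -
  define N where "N = (n + 1) div 2"
  have n: "Suc n = 2 * N" using assms(1) by (auto simp: N_def elim!: oddE)
  define p where "p = q^2"
  define a where "a = q ^ n"
  have a0: "a \<noteq> 0" and p0: "p \<noteq> 0" using q0 by (auto simp: a_def p_def)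
  have pN: "p ^ N = a * q" by (simp add: p_def a_def n[symmetric] power_mult[symmetric])
  have pj: "p ^ j = q ^ (2 * j)" for j by (simp add: p_def power_mult)
  have q1: "q \<noteq> 1" using q[of 1 0] by auto
  \<comment> \<open>The values of \<open>x\<close> and \<open>y\<close> are forced by
    \<open>A * p = x * D * E\<close> and \<open>A * p = y * B * C\<close>.\<close>
  define x where "x = b * q^3 / a"
  define y where "y = q^3 / (c * d)"
  have xD: "x * (a / q) = b * q^2" and xE: "x * (1 / (b * q)) = q^2 / a"
    and yB: "y * (c / q) = q^2 / d" and yC: "y * (d / q) = q^2 / c"
    using nz q0 a0 by (auto simp: x_def y_def field_simps power2_eq_square power3_eq_cube)
  have Ap: "1 / q * p ^ Suc N = a * q^2" using q0 by (simp add: pN) (simp add: p_def mult_ac)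
  have arg: "x * y * p ^ N = b * q^7 / (c * d)"
    using a0 q0 by (simp add: x_def y_def pN field_simps eval_nat_numeral)
  have last: "p / (p ^ N * x) = 1 / (q^2 * b)"
    unfolding x_def pN unfolding p_def
    using nz a0 q0 by (simp add: field_simps power2_eq_square power3_eq_cube)
  have W: "(\<Sum>r\<le>N. (1 - 1 / q * p ^ (2 * r))
      * (qpoch (1 / q) p r * qpoch (c / q) p r * qpoch (d / q) p r * qpoch (a / q) p r
          * qpoch (1 / (b * q)) p r * qpoch (1 / p ^ N) p r)
      / (qpoch p p r * qpoch (y * (c / q)) p r * qpoch (y * (d / q)) p r * qpoch (x * (a / q)) p r
          * qpoch (x * (1 / (b * q))) p r * qpoch (1 / q * p ^ Suc N) p r) * (x * y * p ^ N) ^ r)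
    = qpoch (1 / q) p (Suc N) * qpoch x p N / (qpoch (x * (a / q)) p N * qpoch (x * (1 / (b * q))) p N)
      * (\<Sum>k\<le>N. qpoch (a / q) p k * qpoch (1 / (b * q)) p k * qpoch (1 / p ^ N) p k * qpoch y p k
          / (qpoch p p k * qpoch (y * (c / q)) p k * qpoch (y * (d / q)) p k
              * qpoch (p / (p ^ N * x)) p k) * p ^ k)"
  proof (rule q_Watson_8phi7)
    fix j
    show "p ^ Suc j \<noteq> 1" using q[of "2 * Suc j" 0] unfolding pj by auto
    show "1 / q * p ^ j \<noteq> 1"
      using q[of "2 * j" 1] q0 unfolding pj by (auto simp: field_simps)
    show "y * (c / q) * p ^ j \<noteq> 1"
      using d[of 0 "2 * Suc j"] nz unfolding yB pj by (auto simp: field_simps power2_eq_square)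
    show "y * (d / q) * p ^ j \<noteq> 1"
      using c[of 0 "2 * Suc j"] nz unfolding yC pj by (auto simp: field_simps power2_eq_square)
    show "x * (a / q) * p ^ j \<noteq> 1"
      using b[of "2 * Suc j" 0] unfolding xD pj by (auto simp: field_simps power2_eq_square)
    \<comment> \<open>Equality would mean \<open>q ^ (2 * Suc j) = q ^ n\<close>, which is excluded
      because \<open>n\<close> is odd.\<close>
    show "x * (1 / (b * q)) * p ^ j \<noteq> 1"
      using q[of "2 * Suc j" n] a0 assms(1) unfolding xE pj
      by (auto simp: field_simps power2_eq_square a_def)
    show "x * p ^ j \<noteq> 1"
      using b[of "3 + 2 * j" n] a0 unfolding x_def pj
      by (auto simp: field_simps a_def power_add)
    show "1 / q * p = y * (c / q) * (d / q)" "1 / q * p = x * (a / q) * (1 / (b * q))"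
      unfolding yB xD using nz q0 by (auto simp: p_def field_simps power2_eq_square)
    show "x \<noteq> 0" using nz a0 q0 by (simp add: x_def)
  qed (use p0 in auto)
  have "(\<Sum>k\<le>M. lhs_term q a b c d k) = (\<Sum>k\<le>N. lhs_term q a b c d k)"
  proof (rule sum.mono_neutral_right)
    show "\<forall>k\<in>{..M} - {..N}. lhs_term q a b c d k = 0"
    proof
      fix k assume "k \<in> {..M} - {..N}"
      then have "N < k" by auto
      moreover have "1 - 1 / (a * q) * p ^ N = 0" using a0 q0 by (simp add: pN)
      ultimately have "qpoch (1 / (a * q)) p k = 0" by (auto simp: qpoch_def)
      then show "lhs_term q a b c d k = 0" by (simp add: lhs_term_def qpochs_def p_def)
    qed
  qed (use assms(2) in \<open>auto simp: N_def\<close>)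
  also have "\<dots> = 1 / (1 - q) * (\<Sum>r\<le>N. (1 - 1 / q * p ^ (2 * r))
      * (qpoch (1 / q) p r * qpoch (c / q) p r * qpoch (d / q) p r * qpoch (a / q) p r
          * qpoch (1 / (b * q)) p r * qpoch (1 / p ^ N) p r)
      / (qpoch p p r * qpoch (y * (c / q)) p r * qpoch (y * (d / q)) p r * qpoch (x * (a / q)) p r
          * qpoch (x * (1 / (b * q))) p r * qpoch (1 / q * p ^ Suc N) p r) * (x * y * p ^ N) ^ r)"
    unfolding xD xE yB yC Ap arg unfolding pN sum_distrib_left
      lhs_term_def qint_4k_minus_1[OF q0] p_def[symmetric]
    by (intro sum.cong refl) (simp add: qpochs_def mult_ac)
  also have "\<dots> = 1 / (1 - q) * (qpoch (1 / q) p (Suc N) * qpoch x p N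
      / (qpoch (b * q^2) p N * qpoch (q^2 / a) p N)) * (\<Sum>k\<le>N. rhs_term q a b c d k)"
  proof -
    have "rhs_term q a b c d k = qpoch (a / q) p k * qpoch (1 / (b * q)) p k * qpoch (1 / (a * q)) p k
        * qpoch y p k / (qpoch p p k * qpoch (q^2 / d) p k * qpoch (q^2 / c) p k
              * qpoch (1 / (q^2 * b)) p k) * p ^ k" for k
      unfolding rhs_term_def qpochs_def y_def p_def power_mult by (simp add: mult_ac)
    then show ?thesis
      unfolding W unfolding xD xE yB yC last unfolding pN by (simp only: mult.assoc)
  qed
  \<comment> \<open>Both \<open>(x;p)_N\<close> and \<open>(q^2/a;p)_N\<close> are reflected. As
    \<open>x = (b q) (q^2/a)\<close>, their sign products differ by \<open>(b q)^N\<close>; then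
    \<open>(1/q;p)_N\<close> cancels, and the last factor \<open>1 - q ^ n\<close> over
    \<open>1 - q\<close> gives the q-integer of \<open>n\<close>.\<close>
  also have "1 / (1 - q) * (qpoch (1 / q) p (Suc N) * qpoch x p N
      / (qpoch (b * q^2) p N * qpoch (q^2 / a) p N)) = rhs_factor q b n"
  proof -
    have "qpoch x p N = (\<Prod>j<N. - (x * p ^ j)) * qpoch (1 / (q^2 * b)) p N"
    proof (rule qpoch_reflect)
      show "x * (1 / (q^2 * b)) * p ^ N = p"
        unfolding x_def pN unfolding p_def
        using q0 a0 nz by (simp add: field_simps power2_eq_square power3_eq_cube)
    qed (rule p0)
    moreover have "qpoch (q^2 / a) p N = (\<Prod>j<N. - (q^2 / a * p ^ j)) * qpoch (1 / q) p N"
    proof (rule qpoch_reflect)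
      show "q^2 / a * (1 / q) * p ^ N = p"
        unfolding pN unfolding p_def using q0 a0 by simp
    qed (rule p0)
    moreover have "(\<Prod>j<N. - (x * p ^ j)) = (b * q) ^ N * (\<Prod>j<N. - (q^2 / a * p ^ j))"
    proof -
      have "(\<Prod>j<N. - (x * p ^ j)) = (\<Prod>j<N. (b * q) * - (q^2 / a * p ^ j))"
        using a0 by (simp add: x_def power2_eq_square power3_eq_cube mult_ac)
      then show ?thesis by (simp only: prod.distrib prod_constant card_lessThan power_mult_distrib)
    qed
    moreover have "qpoch (1 / q) p (Suc N) = qpoch (1 / q) p N * (1 - q ^ n)"
      using q0 by (simp add: qpoch_Suc pN a_def)
    moreover have "qpoch (1 / q) p N \<noteq> 0"
    proof (rule qpoch_nonzero)
      fix j show "1 / q * p ^ j \<noteq> 1"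
        using q[of "2 * j" 1] q0 unfolding pj by (auto simp: field_simps)
    qed
    moreover have "(\<Prod>j<N. - (q^2 / a * p ^ j)) \<noteq> 0" using q0 a0 p0 by simp
    ultimately show ?thesis unfolding rhs_factor_def N_def[symmetric] using q1
      by (simp add: p_def[symmetric] qint_def del: prod_zero_iff)
  qed
  finally show ?thesis unfolding a_def N_def .
qed

section \<open>Reversal of the summands at a root of unity\<close>

text \<open>Both sides equal \<open>qpoch (x / q) (q^2) (k + s)\<close> times a power of
  \<open>q\<close> that is symmetric in \<open>k\<close> and \<open>s\<close>: split this symbol at
  either index and reflect the tail. The cross-multiplied form keeps denominators away.\<close>

lemma qpoch_reverse_root_of_unity:
  fixes x q :: "'a::field"
  assumes "q ^ (2 * (k + s)) = q" and q0: "q \<noteq> 0" and x0: "x \<noteq> 0"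
  shows "qpoch (x / q) (q^2) s * (- x) ^ k * q ^ (s * Suc s) * qpoch (q^2 / x) (q^2) k
    = qpoch (x / q) (q^2) k * (- x) ^ s * q ^ (k * Suc k) * qpoch (q^2 / x) (q^2) s"
proof -
  have *: "qpoch (x / q) (q^2) (s + k) * q ^ (k * Suc k)
      = qpoch (x / q) (q^2) s * (- x) ^ k * qpoch (q^2 / x) (q^2) k"
    if qs: "q ^ (2 * (k + s)) = q" for k s
  proof -
    have qq: "(q^2) ^ k * (q^2) ^ s = q"
      using qs by (simp add: power_mult[symmetric] power_add[symmetric] algebra_simps)
    have "qpoch (x / q * (q^2) ^ s) (q^2) k
        = (\<Prod>j<k. - (x / q * (q^2) ^ s * (q^2) ^ j)) * qpoch (q^2 / x) (q^2) k"
    proof (rule qpoch_reflect)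
      have "x / q * (q^2) ^ s * (q^2 / x) * (q^2) ^ k = q^2 / q * ((q^2) ^ k * (q^2) ^ s)"
        using x0 by (simp add: mult_ac)
      then show "x / q * (q^2) ^ s * (q^2 / x) * (q^2) ^ k = q^2" unfolding qq using q0 by simp
    qed (use q0 in simp)
    \<comment> \<open>Because \<open>q\<close> is itself \<open>q ^ (2 * (k + s))\<close>, each
      factor is \<open>- x\<close> divided by an even power of \<open>q\<close>, and these powers
      multiply to \<open>q ^ (k * Suc k)\<close>.\<close>
    moreover have "(\<Prod>j<k. - (x / q * (q^2) ^ s * (q^2) ^ j)) * q ^ (k * Suc k) = (- x) ^ k"
    proof -
      have "(\<Prod>j<k. - (x / q * (q^2) ^ s * (q^2) ^ j)) = (\<Prod>j<k. - x / (q^2) ^ Suc (k - Suc j))"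
      proof (intro prod.cong refl)
        fix j assume "j \<in> {..<k}"
        then have "k = Suc (k - Suc j) + j" by simp
        then have "(q^2) ^ k = (q^2) ^ Suc (k - Suc j) * (q^2) ^ j" by (metis power_add)
        then have "q = (q^2) ^ Suc (k - Suc j) * (q^2) ^ j * (q^2) ^ s" using qq by simp
        then have "(q^2) ^ s * (q^2) ^ j / q = 1 / (q^2) ^ Suc (k - Suc j)"
          using q0 by (simp add: field_simps)
        moreover have "- (x / q * (q^2) ^ s * (q^2) ^ j) = - x * ((q^2) ^ s * (q^2) ^ j / q)" by simp
        ultimately show "- (x / q * (q^2) ^ s * (q^2) ^ j) = - x / (q^2) ^ Suc (k - Suc j)" by simp
      qed
      also have "\<dots> = (\<Prod>j<k. - x / (q^2) ^ Suc j)"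
        by (rule prod.nat_diff_reindex)
      also have "\<dots> * q ^ (k * Suc k) = (- x) ^ k"
      proof (induction k)
        case (Suc k)
        have "Suc k * Suc (Suc k) = k * Suc k + 2 * Suc k" by (simp add: algebra_simps)
        then have "q ^ (Suc k * Suc (Suc k)) = q ^ (k * Suc k) * (q^2) ^ Suc k"
          by (simp only: power_mult[symmetric] power_add[symmetric])
        then show ?case using Suc.IH q0 by (simp add: mult_ac)
      qed simp
      finally show ?thesis .
    qed
    ultimately show ?thesis by (simp add: qpoch_add mult_ac)
  qed
  have "qpoch (x / q) (q^2) s * (- x) ^ k * q ^ (s * Suc s) * qpoch (q^2 / x) (q^2) k
    = qpoch (x / q) (q^2) (s + k) * q ^ (k * Suc k) * q ^ (s * Suc s)"
    unfolding *[OF assms(1)] by (simp add: mult_ac)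
  also have "\<dots> = (qpoch (x / q) (q^2) (k + s) * q ^ (s * Suc s)) * q ^ (k * Suc k)"
    by (simp add: add_ac mult_ac)
  also have "\<dots> = qpoch (x / q) (q^2) k * (- x) ^ s * q ^ (k * Suc k) * qpoch (q^2 / x) (q^2) s"
    using assms(1) by (subst *) (simp_all add: add_ac mult_ac)
  finally show ?thesis .
qed

text \<open>The reversal is applied to each of the six well-poised pairs. The product of the six
  \<open>- x\<close> is \<open>c * d / b\<close>, which against the argument
  \<open>b q^7 / (c d)\<close> leaves \<open>q ^ 7\<close>, so \<open>V s\<close> and
  \<open>V k\<close> differ only by a power of \<open>q\<close>.\<close>

lemma lhs_term_reverse_root_of_unity:
  fixes q a b c d :: "'a::field"
  assumes qks: "q ^ (2 * (k + s)) = q" and q0: "q \<noteq> 0"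
    and nz: "a \<noteq> 0" "b \<noteq> 0" "c \<noteq> 0" "d \<noteq> 0"
    and den: "\<And>i x. i \<in> {k, s} \<Longrightarrow> x \<in> {a, 1 / a, 1 / b, c, d, 1} \<Longrightarrow> qpoch (q^2 / x) (q^2) i \<noteq> 0"
  shows "lhs_term q a b c d s = - lhs_term q a b c d k"
proof -
  define u where "u i x = qpoch (x / q) (q^2) i / qpoch (q^2 / x) (q^2) i" for i x
  define z where "z = b * q^7 / (c * d)"
  define V where "V i = u i a * u i (1 / a) * u i (1 / b) * u i c * u i d * u i 1 * z ^ i" for i
  have t: "lhs_term q a b c d i = (1 - 1 / q * (q^2) ^ (2 * i)) / (1 - q) * V i" for i
    unfolding lhs_term_def qint_4k_minus_1[OF q0]
    by (simp add: qpochs_def V_def u_def z_def mult_ac)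
  have u: "u s x * ((- x) ^ k * q ^ (s * Suc s)) = u k x * ((- x) ^ s * q ^ (k * Suc k))"
    if "x \<in> {a, 1 / a, 1 / b, c, d, 1}" for x
  proof -
    have "x \<noteq> 0" using that nz by auto
    from qpoch_reverse_root_of_unity[OF qks q0 this] den[OF _ that]
    show ?thesis by (simp add: u_def field_simps)
  qed
  define X where "X = c * d / b"
  have X: "(- a) ^ i * (- (1 / a)) ^ i * (- (1 / b)) ^ i * (- c) ^ i * (- d) ^ i * (- 1) ^ i = X ^ i" for i
    using nz by (simp add: X_def power_mult_distrib[symmetric])
  have Xz: "X * z = q ^ 7" using nz by (simp add: X_def z_def)
  have pe: "q ^ (7 * i + 6 * j) = (q ^ 7) ^ i * (q ^ j) ^ 6" for i j
    by (simp add: power_add power_mult[symmetric] mult.commute)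
  have p6: "t ^ 6 = t * t * t * t * t * t" for t :: 'a
    by (simp add: eval_nat_numeral)
  have "V s * (X ^ k * z ^ k * (q ^ (s * Suc s)) ^ 6)
    = (u s a * ((- a) ^ k * q ^ (s * Suc s))) * (u s (1 / a) * ((- (1 / a)) ^ k * q ^ (s * Suc s)))
      * (u s (1 / b) * ((- (1 / b)) ^ k * q ^ (s * Suc s))) * (u s c * ((- c) ^ k * q ^ (s * Suc s)))
      * (u s d * ((- d) ^ k * q ^ (s * Suc s))) * (u s 1 * ((- 1) ^ k * q ^ (s * Suc s))) * (z ^ k * z ^ s)"
    unfolding V_def X[symmetric] p6 by (simp only: mult_ac)
  also have "\<dots>
    = (u k a * ((- a) ^ s * q ^ (k * Suc k))) * (u k (1 / a) * ((- (1 / a)) ^ s * q ^ (k * Suc k)))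
      * (u k (1 / b) * ((- (1 / b)) ^ s * q ^ (k * Suc k))) * (u k c * ((- c) ^ s * q ^ (k * Suc k)))
      * (u k d * ((- d) ^ s * q ^ (k * Suc k))) * (u k 1 * ((- 1) ^ s * q ^ (k * Suc k))) * (z ^ k * z ^ s)"
    by (simp only: u insertI1 insertI2 singletonI)
  also have "\<dots> = V k * (X ^ s * z ^ s * (q ^ (k * Suc k)) ^ 6)"
    unfolding V_def X[symmetric] p6 by (simp only: mult_ac)
  finally have "V s * q ^ (7 * k + 6 * (s * Suc s)) = V k * q ^ (7 * s + 6 * (k * Suc k))"
    unfolding power_mult_distrib[symmetric] Xz pe .
  \<comment> \<open>The extra factor completes the quadratic part \<open>6 * s * s\<close> of the
    exponent to \<open>6 * s * (k + s)\<close>, and likewise for \<open>k\<close>;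
    \<open>q ^ (2 * (k + s)) = q\<close> then makes the exponents linear.\<close>
  then have "V s * q ^ (7 * k + 6 * (s * Suc s)) * q ^ (6 * s * k + 2 * k + 2 * s)
      = V k * q ^ (7 * s + 6 * (k * Suc k)) * q ^ (6 * s * k + 2 * k + 2 * s)" by simp
  moreover have "q ^ (7 * i + 6 * (j * Suc j)) * q ^ (6 * s * k + 2 * k + 2 * s) = q ^ (9 * (k + s)) * q ^ (2 * j)"
    if "(i, j) \<in> {(k, s), (s, k)}" for i j
  proof -
    have "7 * i + 6 * (j * Suc j) + (6 * s * k + 2 * k + 2 * s) = 2 * (k + s) * (3 * j) + (9 * i + 8 * j)"
      using that by (auto simp: algebra_simps)
    then have "q ^ (7 * i + 6 * (j * Suc j)) * q ^ (6 * s * k + 2 * k + 2 * s)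
      = (q ^ (2 * (k + s))) ^ (3 * j) * q ^ (9 * i + 8 * j)"
      by (simp only: power_add[symmetric] power_mult[symmetric])
    also have "\<dots> = q ^ (3 * j + (9 * i + 8 * j))" unfolding qks by (simp only: power_add)
    also have "3 * j + (9 * i + 8 * j) = 9 * (k + s) + 2 * j" using that by auto
    finally show ?thesis by (simp only: power_add)
  qed
  from this[of k s] this[of s k]
  have "q ^ (7 * k + 6 * (s * Suc s)) * q ^ (6 * s * k + 2 * k + 2 * s) = q ^ (9 * (k + s)) * q ^ (2 * s)"
    "q ^ (7 * s + 6 * (k * Suc k)) * q ^ (6 * s * k + 2 * k + 2 * s) = q ^ (9 * (k + s)) * q ^ (2 * k)"
    by blast+
  ultimately have "q ^ (9 * (k + s)) * (V s * q ^ (2 * s)) = q ^ (9 * (k + s)) * (V k * q ^ (2 * k))"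
    by (simp only: mult.assoc mult.left_commute)
  then have "V s * q ^ (2 * s) = V k * q ^ (2 * k)" using q0 by simp
  then have "V s * (q ^ (2 * s) * q ^ (2 * k)) = V k * (q ^ (2 * k) * q ^ (2 * k))"
    by (simp only: mult.assoc[symmetric])
  moreover have "2 * s + 2 * k = 2 * (k + s)" by simp
  then have "q ^ (2 * s) * q ^ (2 * k) = q"
    by (simp only: power_add[symmetric] qks)
  moreover have "q ^ (2 * k) * q ^ (2 * k) = q ^ (4 * k)"
    by (simp flip: power_add)
  ultimately have "V s * q = V k * q ^ (4 * k)" by simp
  moreover have "(q ^ (2 * (k + s)))^2 = q^2" by (simp only: qks)
  moreover have "4 * s + 4 * k = 2 * (k + s) * 2" by simp
  ultimately have "V s * q = V k * q ^ (4 * k)" "q ^ (4 * s) * q ^ (4 * k) = q^2"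
    by (simp_all only: power_mult[symmetric] power_add[symmetric])
  \<comment> \<open>\<open>q ^ (4 * s) / q\<close> and \<open>q ^ (4 * k) / q\<close> are inverse to
    each other, so passing from \<open>k\<close> to \<open>s\<close> flips the sign of the q-integer
    factor, up to a power that \<open>V\<close> compensates.\<close>
  then have "(1 - 1 / q * q ^ (4 * s)) * V s = - ((1 - 1 / q * q ^ (4 * k)) * V k)"
  proof -
    assume *: "V s * q = V k * q ^ (4 * k)" and **: "q ^ (4 * s) * q ^ (4 * k) = q^2"
    have V: "V s = V k * q ^ (4 * k) / q" using * q0 by (simp add: field_simps)
    have "(1 - 1 / q * q ^ (4 * s)) * V s = V k * q ^ (4 * k) / q - V k * (q ^ (4 * s) * q ^ (4 * k)) / (q * q)"
      unfolding V by (simp add: algebra_simps diff_divide_distrib)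
    also have "\<dots> = V k * q ^ (4 * k) / q - V k" unfolding ** using q0 by (simp add: power2_eq_square)
    finally show ?thesis by (simp add: algebra_simps)
  qed
  then show ?thesis unfolding t by (simp add: power_mult[symmetric])
qed

text \<open>Reflecting the index at \<open>h = (n + 1) / 2\<close> shows that the sum equals its own
  negative; \<open>2 \<noteq> 0\<close> concludes. A middle term, paired with itself, is covered
  too.\<close>

lemma sum_lhs_term_root_of_unity:
  fixes q a b c d :: "'a::field"
  assumes "odd n" and M: "M = (n + 1) div 2 \<or> M = n - 1"
    and qn: "q ^ n = 1" and q: "\<And>j. 0 < j \<Longrightarrow> j < n \<Longrightarrow> q ^ j \<noteq> 1" and two: "(2 :: 'a) \<noteq> 0"
    and n: "n > 1"
    and nz: "a \<noteq> 0" "b \<noteq> 0" "c \<noteq> 0" "d \<noteq> 0"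
    and gen: "\<And>x j. x \<in> {a, 1 / a, 1 / b, c, d} \<Longrightarrow> x \<noteq> q ^ j"
  shows "(\<Sum>k\<le>M. lhs_term q a b c d k) = 0"
proof -
  define h where "h = (n + 1) div 2"
  have h: "2 * h = Suc n" using assms(1) by (auto simp: h_def elim!: oddE)
  have q0: "q \<noteq> 0" using qn n by (auto simp: power_0_left)
  have qh: "q ^ (2 * h) = q" by (simp add: h qn)
  have den: "qpoch (q^2 / x) (q^2) i \<noteq> 0" if "i \<le> h" "x \<in> {a, 1 / a, 1 / b, c, d, 1}" for i x
  proof (rule qpoch_nonzero)
    fix j assume "j < i"
    have x0: "x \<noteq> 0" using that nz by auto
    have "x \<noteq> q ^ (2 * Suc j)"
    proof (cases "x = 1")
      case True
      have j: "Suc j < n" using that \<open>j < i\<close> h n by linarith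
      \<comment> \<open>The exponent lies strictly between 0 and \<open>2 * n\<close> and is even,
        so it differs from \<open>n\<close>; above \<open>n\<close>, subtracting \<open>n\<close>
        brings it into the range of the order hypothesis.\<close>
      have "q ^ (2 * Suc j) \<noteq> 1"
      proof
        assume *: "q ^ (2 * Suc j) = 1"
        show False
        proof (cases "2 * Suc j < n")
          case True
          then show False using q[of "2 * Suc j"] * by simp
        next
          case False
          then have ge: "n < 2 * Suc j"
            using assms(1) by (cases n "2 * Suc j" rule: linorder_cases) auto
          then have "q ^ (2 * Suc j) = q ^ n * q ^ (2 * Suc j - n)"
            by (metis less_imp_le le_add_diff_inverse power_add)
          then have "q ^ (2 * Suc j - n) = 1" using * qn by simp
          moreover have "0 < 2 * Suc j - n" "2 * Suc j - n < n" using ge j by auto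
          ultimately show False using q by blast
        qed
      qed
      then show ?thesis using True by simp
    next
      case False
      then have "x \<in> {a, 1 / a, 1 / b, c, d}" using that by auto
      then show ?thesis by (rule gen)
    qed
    moreover have "q^2 / x * (q^2) ^ j = q ^ (2 * Suc j) / x" unfolding power_mult by simp
    ultimately show "q^2 / x * (q^2) ^ j \<noteq> 1" using x0 by (auto simp: field_simps)
  qed
  have "(\<Sum>k\<le>M. lhs_term q a b c d k) = (\<Sum>k\<le>h. lhs_term q a b c d k)"
  proof (rule sum.mono_neutral_right)
    show "{..h} \<subseteq> {..M}" using M n h unfolding h_def by auto
    show "\<forall>k\<in>{..M} - {..h}. lhs_term q a b c d k = 0"
    proof
      fix k assume "k \<in> {..M} - {..h}"
      then have "h < k" by auto
      moreover have "1 - 1 / q * (q^2) ^ h = 0" using q0 qh by (simp add: power_mult[symmetric])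
      ultimately have "qpoch (1 / q) (q^2) k = 0" by (auto simp: qpoch_def)
      then show "lhs_term q a b c d k = 0" by (simp add: lhs_term_def qpochs_def)
    qed
  qed auto
  moreover have "(\<Sum>k\<le>h. lhs_term q a b c d k) = (\<Sum>k\<le>h. - lhs_term q a b c d k)"
  proof -
    have "(\<Sum>k\<le>h. lhs_term q a b c d k) = (\<Sum>k\<le>h. lhs_term q a b c d (h - k))"
      using sum.nat_diff_reindex[of "lhs_term q a b c d" "Suc h"]
      by (simp add: lessThan_Suc_atMost del: sum.lessThan_Suc)
    also have "\<dots> = (\<Sum>k\<le>h. - lhs_term q a b c d k)"
      using qh q0 nz by (intro sum.cong refl lhs_term_reverse_root_of_unity den) auto
    finally show ?thesis .
  qed
  ultimately have "(\<Sum>k\<le>M. lhs_term q a b c d k) = - (\<Sum>k\<le>M. lhs_term q a b c d k)"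
    by (metis sum_negf)
  then show ?thesis unfolding eq_neg_iff_add_eq_0 mult_2[symmetric] using two by simp
qed

section \<open>Ring homomorphisms and cyclotomic polynomials\<close>

locale unital_ring_hom =
  fixes f :: "'a::comm_ring_1 \<Rightarrow> 'b::comm_ring_1"
  assumes hom_add: "f (x + y) = f x + f y"
    and hom_mult: "f (x * y) = f x * f y"
    and hom_one [simp]: "f 1 = 1"
begin

lemma hom_zero [simp]: "f 0 = 0"
  using hom_add[of 0 0] by simp

lemma hom_uminus: "f (- x) = - f x"
  using hom_add[of x "- x"] by (simp add: eq_neg_iff_add_eq_0 add.commute)

lemma hom_diff: "f (x - y) = f x - f y"
  using hom_add[of x "- y"] by (simp add: hom_uminus)

lemma hom_power: "f (x ^ n) = f x ^ n"
  by (induction n) (simp_all add: hom_mult)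

lemma hom_sum: "f (sum g A) = (\<Sum>x\<in>A. f (g x))"
  by (induction A rule: infinite_finite_induct) (simp_all add: hom_add)

lemma hom_prod: "f (prod g A) = (\<Prod>x\<in>A. f (g x))"
  by (induction A rule: infinite_finite_induct) (simp_all add: hom_mult)

lemma hom_of_nat: "f (of_nat n) = of_nat n"
  by (induction n) (simp_all add: hom_add)

lemma hom_of_int: "f (of_int n) = of_int n"
  by (cases n rule: int_cases2) (simp_all add: hom_of_nat hom_uminus)

lemma hom_dvd: "x dvd y \<Longrightarrow> f x dvd f y"
  by (auto simp: hom_mult elim!: dvdE)

lemma unital_ring_hom_map_poly: "unital_ring_hom (map_poly f)"
  by unfold_locales
    (auto intro!: poly_eqI simp: coeff_map_poly hom_add hom_mult hom_sum coeff_mult)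

end

lemma unital_ring_hom_compose:
  "unital_ring_hom f \<Longrightarrow> unital_ring_hom g \<Longrightarrow> unital_ring_hom (\<lambda>x. f (g x))"
  by (simp add: unital_ring_hom_def)

lemma unital_ring_hom_to_fract: "unital_ring_hom to_fract"
  by unfold_locales simp_all

lemma unital_ring_hom_of_int: "unital_ring_hom of_int"
  by unfold_locales simp_all

lemma unital_ring_hom_poly: "unital_ring_hom (\<lambda>p. poly p x)"
  by unfold_locales simp_all

lemma unital_ring_hom_const: "unital_ring_hom (\<lambda>c. [:c:])"
  by unfold_locales (simp_all add: one_pCons)

section \<open>Primitive roots of unity and cyclotomic polynomials\<close>

definition primitive_roots :: "nat \<Rightarrow> complex set" where
  "primitive_roots n = {z. z ^ n = 1 \<and> (\<forall>m. 0 < m \<and> m < n \<longrightarrow> z ^ m \<noteq> 1)}"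

lemma finite_primitive_roots: "n > 0 \<Longrightarrow> finite (primitive_roots n)"
  by (rule finite_subset[OF _ finite_roots_unity[of n]]) (auto simp: primitive_roots_def)

lemma primitive_roots_power_eq_1_iff:
  assumes "z \<in> primitive_roots n" "n > 0"
  shows "z ^ m = 1 \<longleftrightarrow> n dvd m"
proof
  have zn: "z ^ n = 1" using assms by (simp add: primitive_roots_def)
  have "z ^ m = (z ^ n) ^ (m div n) * z ^ (m mod n)"
    by (simp only: power_mult[symmetric] power_add[symmetric]) simp
  then have "z ^ m = z ^ (m mod n)" by (simp add: zn)
  moreover assume "z ^ m = 1"
  moreover have "m mod n < n" using assms(2) by simp
  ultimately have "m mod n = 0" using assms(1) by (auto simp: primitive_roots_def)
  then show "n dvd m" by auto
next
  assume "n dvd m"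
  then show "z ^ m = 1" using assms by (auto simp: primitive_roots_def power_mult elim!: dvdE)
qed

lemma cis_power_eq_1_iff:
  assumes "n > 0"
  shows "cis (2 * pi * real k / real n) ^ m = 1 \<longleftrightarrow> n dvd k * m"
proof -
  have "cis (2 * pi * real k / real n) ^ m = cis (2 * pi * real (k * m) / real n)"
    by (simp add: DeMoivre mult_ac)
  also have "\<dots> = 1 \<longleftrightarrow> cos (2 * pi * real (k * m) / real n) = 1"
    by (auto simp: complex_eq_iff cos_one_sin_zero)
  also have "\<dots> \<longleftrightarrow> (\<exists>i::int. 2 * pi * real (k * m) / real n = of_int i * 2 * pi)"
    by (rule cos_one_2pi_int)
  also have "\<dots> \<longleftrightarrow> (\<exists>i::int. int (k * m) = i * int n)"
  proof (intro ex_cong1)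
    fix i :: int
    have "2 * pi * real (k * m) / real n = of_int i * 2 * pi \<longleftrightarrow> real (k * m) = of_int i * real n"
      using assms by (simp add: field_simps)
    also have "\<dots> \<longleftrightarrow> real_of_int (int (k * m)) = real_of_int (i * int n)" by simp
    also have "\<dots> \<longleftrightarrow> int (k * m) = i * int n" by (rule of_int_eq_iff)
    finally show "2 * pi * real (k * m) / real n = of_int i * 2 * pi \<longleftrightarrow> int (k * m) = i * int n" .
  qed
  also have "\<dots> \<longleftrightarrow> int n dvd int (k * m)" by (auto simp: dvd_def mult.commute)
  also have "\<dots> \<longleftrightarrow> n dvd k * m" by (rule int_dvd_int_iff)
  finally show ?thesis .
qed

lemma bij_betw_primitive_roots:
  assumes "n > 0"
  shows "bij_betw (\<lambda>k. cis (2 * pi * real k / real n)) {k \<in> {1..n}. coprime k n} (primitive_roots n)"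
proof -
  let ?f = "\<lambda>k::nat. cis (2 * pi * real k / real n)"
  have bij: "bij_betw ?f {..<n} {z. z ^ n = 1}" by (rule bij_betw_roots_unity[OF assms])
  \<comment> \<open>The indices of the definition run over \<open>{1..n}\<close>, those of the
    library bijection over \<open>{..<n}\<close>; \<open>n\<close> and 0 give the same
    point.\<close>
  have per: "?f n = ?f 0" using assms by simp
  have prim: "?f k \<in> primitive_roots n \<longleftrightarrow> coprime k n" for k
  proof
    assume k: "?f k \<in> primitive_roots n"
    define g where "g = gcd k n"
    have g: "g > 0" "g dvd n" "g dvd k" using assms by (auto simp: g_def)
    have "n dvd k * (n div g)" using g by (metis div_mult_swap dvd_div_mult dvd_triv_right mult.commute)
    then have "?f k ^ (n div g) = 1" using cis_power_eq_1_iff[OF assms] by blast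
    moreover have "n div g > 0" using g assms by (simp add: div_greater_zero_iff dvd_imp_le)
    ultimately have "\<not> n div g < n" using k by (auto simp: primitive_roots_def)
    then have "g = 1" using g assms by (metis One_nat_def Suc_lessI div_less_dividend)
    then show "coprime k n" by (simp add: g_def coprime_iff_gcd_eq_1)
  next
    assume "coprime k n"
    then have "?f k ^ m = 1 \<longleftrightarrow> n dvd m" for m
      unfolding cis_power_eq_1_iff[OF assms] by (simp add: coprime_commute coprime_dvd_mult_right_iff)
    then show "?f k \<in> primitive_roots n"
      by (auto simp: primitive_roots_def dest: dvd_imp_le simp del: One_nat_def)
  qed
  show ?thesis
  proof (rule bij_betwI')
    fix i j assume *: "i \<in> {k \<in> {1..n}. coprime k n}" "j \<in> {k \<in> {1..n}. coprime k n}"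
    show "?f i = ?f j \<longleftrightarrow> i = j"
    proof
      assume e: "?f i = ?f j"
      have "?f (i mod n) = ?f i" "?f (j mod n) = ?f j"
        using * per by (auto simp: le_less)
      then have "i mod n = j mod n"
        using e bij assms unfolding bij_betw_def inj_on_def by auto
      then show "i = j" using * by (auto simp: le_less)
    qed simp
  next
    fix k assume "k \<in> {k \<in> {1..n}. coprime k n}"
    then show "?f k \<in> primitive_roots n" using prim by simp
  next
    fix z assume z: "z \<in> primitive_roots n"
    then have "z \<in> ?f ` {..<n}" using bij by (auto simp: bij_betw_def primitive_roots_def)
    then obtain k where k: "k < n" "z = ?f k" by auto
    show "\<exists>k\<in>{k \<in> {1..n}. coprime k n}. z = ?f k"
    proof (cases "k = 0")
      case True
      then show ?thesis using k z prim[of n] per assms by (intro bexI[of _ n]) auto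
    next
      case False
      then show ?thesis using k z prim[of k] by (intro bexI[of _ k]) auto
    qed
  qed
qed

lemma cyclotomic_complex_eq:
  assumes "n > 0"
  shows "cyclotomic_complex n = (\<Prod>z\<in>primitive_roots n. [:- z, 1:])"
  unfolding cyclotomic_complex_def
  using prod.reindex_bij_betw[OF bij_betw_primitive_roots[OF assms], of "\<lambda>z. [:- z, 1:]"] by simp

lemma roots_unity_eq_Union_primitive_roots:
  assumes "n > 0"
  shows "{z. z ^ n = 1} = (\<Union>k\<in>{k. k dvd n}. primitive_roots k)"
proof (intro set_eqI iffI)
  fix z :: complex assume "z \<in> {z. z ^ n = 1}"
  then have zn: "z ^ n = 1" by simp
  define k where "k = (LEAST k. k > 0 \<and> z ^ k = 1)"
  have k: "k > 0 \<and> z ^ k = 1" unfolding k_def by (rule LeastI[of _ n]) (use assms zn in simp)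
  have min: "\<not> (m > 0 \<and> z ^ m = 1)" if "m < k" for m
    using that unfolding k_def by (rule not_less_Least)
  have "z ^ (n mod k) = 1"
  proof -
    have "z ^ n = (z ^ k) ^ (n div k) * z ^ (n mod k)"
      by (simp only: power_mult[symmetric] power_add[symmetric]) simp
    then show ?thesis using zn k by simp
  qed
  then have "n mod k = 0" using min[of "n mod k"] k by auto
  then show "z \<in> (\<Union>k\<in>{k. k dvd n}. primitive_roots k)"
    using k min by (auto simp: primitive_roots_def)
next
  fix z assume "z \<in> (\<Union>k\<in>{k. k dvd n}. primitive_roots k)"
  then show "z \<in> {z. z ^ n = 1}" by (auto simp: primitive_roots_def power_mult elim!: dvdE)
qed

lemma primitive_roots_disjoint:
  assumes "0 < k" "0 < m" "k \<noteq> m"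
  shows "primitive_roots k \<inter> primitive_roots m = {}"
  using assms by (cases k m rule: linorder_cases) (auto simp: primitive_roots_def)

text \<open>Two polynomials of degree at most \<open>n\<close> with the same coefficient at
  \<open>n\<close> are equal once they agree at \<open>n\<close> points.\<close>

lemma prod_linear_roots_unity:
  assumes "n > 0"
  shows "(\<Prod>z\<in>{z::complex. z ^ n = 1}. [:- z, 1:]) = monom 1 n - 1"
proof (rule poly_eqI_degree_lead_coeff[where A = "{z::complex. z ^ n = 1}" and n = n])
  have card: "card {z::complex. z ^ n = 1} = n" by (rule card_roots_unity_eq[OF assms])
  have deg: "degree (\<Prod>z\<in>{z::complex. z ^ n = 1}. [:- z, 1:]) = n"
    by (subst degree_prod_eq_sum_degree) (simp_all add: card)
  show "coeff (\<Prod>z\<in>{z::complex. z ^ n = 1}. [:- z, 1:]) n = coeff (monom 1 n - 1) n"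
    using assms lead_coeff_prod[of "\<lambda>z::complex. [:- z, 1:]" "{z. z ^ n = 1}"] deg by simp
  show "degree (\<Prod>z\<in>{z::complex. z ^ n = 1}. [:- z, 1:]) \<le> n" using deg by simp
  show "degree (monom (1::complex) n - 1) \<le> n"
    by (rule degree_diff_le) (simp_all add: degree_monom_le)
  show "card {z::complex. z ^ n = 1} \<ge> n" using card by simp
  fix z :: complex assume "z \<in> {z. z ^ n = 1}"
  then show "poly (\<Prod>z\<in>{z::complex. z ^ n = 1}. [:- z, 1:]) z = poly (monom 1 n - 1) z"
    using finite_roots_unity[of n] assms
    by (auto simp: poly_prod poly_monom intro!: prod_zero bexI[of _ z])
qed

lemma prod_cyclotomic_complex:
  assumes "n > 0"
  shows "(\<Prod>k | k dvd n. cyclotomic_complex k) = monom 1 n - 1"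
proof -
  have fin: "finite {k. k dvd n}" using assms by simp
  have pos: "k > 0" if "k dvd n" for k using that assms by (auto intro!: Nat.gr0I)
  have "monom 1 n - 1 = (\<Prod>z\<in>(\<Union>k\<in>{k. k dvd n}. primitive_roots k). [:- z, 1:])"
    unfolding roots_unity_eq_Union_primitive_roots[OF assms, symmetric]
    by (rule prod_linear_roots_unity[OF assms, symmetric])
  also have "\<dots> = (\<Prod>k | k dvd n. \<Prod>z\<in>primitive_roots k. [:- z, 1:])"
    by (rule prod.UNION_disjoint)
      (use fin pos finite_primitive_roots primitive_roots_disjoint in auto)
  also have "\<dots> = (\<Prod>k | k dvd n. cyclotomic_complex k)"
    using pos by (intro prod.cong) (auto simp: cyclotomic_complex_eq)
  finally show ?thesis by simp
qed

section \<open>Integrality of the cyclotomic polynomials\<close>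

text \<open>Pseudo-division scales the dividend by a power of the leading coefficient, here
  1.\<close>

lemma monic_division:
  fixes p g :: "'a::idom poly"
  assumes "lead_coeff g = 1"
  obtains s r where "p = g * s + r" and "r = 0 \<or> degree r < degree g"
proof -
  have "g \<noteq> 0" using assms by auto
  obtain s r where "pseudo_divmod p g = (s, r)" by (cases "pseudo_divmod p g")
  from pseudo_divmod[OF \<open>g \<noteq> 0\<close> this] show ?thesis
    using assms that by simp
qed

abbreviation complex_poly :: "int poly \<Rightarrow> complex poly" where
  "complex_poly \<equiv> map_poly of_int"

interpretation complex_poly: unital_ring_hom complex_poly
  by (rule unital_ring_hom.unital_ring_hom_map_poly[OF unital_ring_hom_of_int])

lemma coeff_complex_poly [simp]: "coeff (complex_poly p) i = of_int (coeff p i)"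
  by (simp add: coeff_map_poly)

lemma degree_complex_poly [simp]: "degree (complex_poly p) = degree p"
  by (rule degree_map_poly) simp

lemma complex_poly_eq_iff: "complex_poly p = complex_poly p' \<longleftrightarrow> p = p'"
  by (auto simp: poly_eq_iff)

lemma complex_poly_eq_0_iff [simp]: "complex_poly p = 0 \<longleftrightarrow> p = 0"
  using complex_poly_eq_iff[of p 0] by simp

text \<open>Division with remainder by a monic \<open>g\<close> already works over the integers;
  over the complex numbers \<open>g\<close> divides the remainder, whose degree is too small unless
  it is 0.\<close>

lemma complex_poly_dvd_monic:
  assumes "lead_coeff g = 1" and "complex_poly g dvd complex_poly p"
  shows "g dvd p"
proof -
  obtain s r where sr: "p = g * s + r" "r = 0 \<or> degree r < degree g"
    by (rule monic_division[OF assms(1)])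
  have "complex_poly g dvd complex_poly r"
    using assms(2) unfolding sr(1) complex_poly.hom_add complex_poly.hom_mult
    by (simp add: dvd_add_right_iff)
  then have "r \<noteq> 0 \<Longrightarrow> degree g \<le> degree r"
    using dvd_imp_degree_le[of "complex_poly g" "complex_poly r"] by simp
  then have "r = 0" using sr(2) by linarith
  then show ?thesis using sr(1) by simp
qed

lemma lead_coeff_cyclotomic_complex: "lead_coeff (cyclotomic_complex n) = 1"
  by (simp add: cyclotomic_complex_def lead_coeff_prod)

text \<open>Shows that the \<open>THE\<close> in \<open>cyclotomic\<close> is well defined. By
  strong induction the product over the proper divisors of \<open>n\<close> is a monic integer
  polynomial, so its cofactor in \<open>X^n - 1\<close> is integral.\<close>

lemma complex_poly_cyclotomic:
  assumes "n > 0"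
  shows "complex_poly (cyclotomic n) = cyclotomic_complex n"
proof -
  have "\<exists>p. complex_poly p = cyclotomic_complex n"
    using assms
  proof (induction n rule: less_induct)
    case (less n)
    let ?K = "{k. k dvd n \<and> k \<noteq> n}"
    have K: "0 < k \<and> k < n" if "k \<in> ?K" for k
      using that less.prems by (metis (mono_tags, lifting) dvd_imp_le dvd_pos_nat le_neq_implies_less mem_Collect_eq)
    have fin: "finite ?K" using less.prems by (auto intro: finite_subset[of _ "{k. k dvd n}"])
    obtain P where P: "complex_poly (P k) = cyclotomic_complex k" if "k \<in> ?K" for k
      using less.IH K by metis
    define Q where "Q = prod P ?K"
    have Q: "complex_poly Q = (\<Prod>k\<in>?K. cyclotomic_complex k)"
      unfolding Q_def complex_poly.hom_prod using P by (intro prod.cong) auto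
    have "of_int (lead_coeff Q) = lead_coeff (complex_poly Q)" by simp
    also have "\<dots> = 1"
      unfolding Q lead_coeff_prod by (simp add: lead_coeff_cyclotomic_complex)
    finally have lQ: "lead_coeff Q = 1" by (simp only: of_int_eq_1_iff)
    have "{k. k dvd n} = insert n ?K" by auto
    then have "cyclotomic_complex n * complex_poly Q = monom 1 n - 1"
      using prod_cyclotomic_complex[OF less.prems] fin by (simp add: Q)
    also have "monom 1 n - 1 = complex_poly (monom 1 n - 1)"
      by (simp add: complex_poly.hom_diff map_poly_monom)
    finally have e: "cyclotomic_complex n * complex_poly Q = complex_poly (monom 1 n - 1)" .
    then have "Q dvd monom 1 n - 1"
      using lQ by (intro complex_poly_dvd_monic) (auto intro: dvdI[of _ _ "cyclotomic_complex n"] simp: mult.commute)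
    then obtain S where S: "monom 1 n - 1 = Q * S" by (auto elim: dvdE)
    have "Q \<noteq> 0" using lQ by auto
    then have "complex_poly S = cyclotomic_complex n"
      using e unfolding S complex_poly.hom_mult by (simp add: mult.commute)
    then show ?case by blast
  qed
  then have "\<exists>!p. complex_poly p = cyclotomic_complex n"
    using complex_poly_eq_iff by metis
  then show ?thesis unfolding cyclotomic_def by (rule theI')
qed

lemma lead_coeff_cyclotomic: "n > 0 \<Longrightarrow> lead_coeff (cyclotomic n) = 1"
  using lead_coeff_cyclotomic_complex[of n] complex_poly_cyclotomic[of n, symmetric] by simp

lemma poly_cyclotomic_eq_0_iff:
  assumes "n > 0"
  shows "poly (complex_poly (cyclotomic n)) z = 0 \<longleftrightarrow> z \<in> primitive_roots n"
  using finite_primitive_roots[OF assms]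
  by (auto simp: complex_poly_cyclotomic[OF assms] cyclotomic_complex_eq[OF assms] poly_prod prod_zero_iff)

text \<open>The roots are distinct, so the linear factors can be split off one after the other over
  the complex numbers; monicity brings the divisibility back to the integers.\<close>

lemma cyclotomic_dvdI:
  assumes "n > 0" and "\<And>z. z \<in> primitive_roots n \<Longrightarrow> poly (complex_poly p) z = 0"
  shows "cyclotomic n dvd p"
proof (rule complex_poly_dvd_monic)
  show "lead_coeff (cyclotomic n) = 1" by (rule lead_coeff_cyclotomic[OF assms(1)])
  have "(\<Prod>z\<in>A. [:- z, 1:]) dvd P" if "finite A" "\<And>z. z \<in> A \<Longrightarrow> poly P z = 0" for A and P :: "complex poly"
    using that
  proof (induction A arbitrary: P rule: finite_induct)
    case (insert w A)
    then have "[:- w, 1:] dvd P" by (simp add: poly_eq_0_iff_dvd)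
    then obtain S where S: "P = [:- w, 1:] * S" by (elim dvdE)
    have "poly S z = 0" if "z \<in> A" for z
    proof -
      have "poly P z = 0" "z \<noteq> w" using insert that by auto
      then show ?thesis unfolding S by simp
    qed
    then have "(\<Prod>z\<in>A. [:- z, 1:]) dvd S" by (rule insert.IH)
    then show ?case unfolding S prod.insert[OF insert.hyps] by (rule mult_dvd_mono[OF dvd_refl])
  qed simp
  then show "complex_poly (cyclotomic n) dvd complex_poly p"
    unfolding complex_poly_cyclotomic[OF assms(1)] cyclotomic_complex_eq[OF assms(1)]
    using assms finite_primitive_roots by blast
qed

section \<open>Specialization of rational functions\<close>

locale specialization = unital_ring_hom f
  for f :: "'a::{factorial_ring_gcd,semiring_gcd_mult_normalize} \<Rightarrow> 'b::field"
begin

text \<open>A relation, because \<open>f\<close> extends only to those fractions that have a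
  denominator outside its kernel.\<close>

definition spec :: "'a fract \<Rightarrow> 'b \<Rightarrow> bool" where
  "spec x y \<longleftrightarrow> (\<exists>N D. f D \<noteq> 0 \<and> x = to_fract N / to_fract D \<and> y = f N / f D)"

lemma specI: "f D \<noteq> 0 \<Longrightarrow> x = to_fract N / to_fract D \<Longrightarrow> y = f N / f D \<Longrightarrow> spec x y"
  by (auto simp: spec_def)

lemma specE:
  assumes "spec x y"
  obtains N D where "f D \<noteq> 0" "to_fract D \<noteq> 0" "x = to_fract N / to_fract D" "y = f N / f D"
  using assms by (auto simp: spec_def) (metis hom_zero to_fract_eq_0_iff)

lemma spec_to_fract: "y = f x \<Longrightarrow> spec (to_fract x) y"
  by (rule specI[of 1 _ x]) simp_all

lemma spec_1: "spec 1 1"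
  using spec_to_fract[of 1 1] by simp

lemma spec_0: "spec 0 0"
  using spec_to_fract[of 0 0] by simp

lemma spec_add: "spec x y \<Longrightarrow> spec x' y' \<Longrightarrow> spec (x + x') (y + y')"
  apply (elim specE)
  subgoal for N D N' D'
    by (rule specI[of "D * D'" _ "N * D' + N' * D"]) (simp_all add: hom_mult hom_add field_simps)
  done

lemma spec_diff: "spec x y \<Longrightarrow> spec x' y' \<Longrightarrow> spec (x - x') (y - y')"
  apply (elim specE)
  subgoal for N D N' D'
    by (rule specI[of "D * D'" _ "N * D' - N' * D"]) (simp_all add: hom_mult hom_diff diff_frac_eq)
  done

lemma spec_mult: "spec x y \<Longrightarrow> spec x' y' \<Longrightarrow> spec (x * x') (y * y')"
  apply (elim specE)
  subgoal for N D N' D'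
    by (rule specI[of "D * D'" _ "N * N'"]) (simp_all add: hom_mult)
  done

lemma spec_divide: "spec x y \<Longrightarrow> spec x' y' \<Longrightarrow> y' \<noteq> 0 \<Longrightarrow> spec (x / x') (y / y')"
  apply (elim specE)
  subgoal for N D N' D'
    by (rule specI[of "D * N'" _ "N * D'"]) (simp_all add: hom_mult)
  done

lemma spec_power: "spec x y \<Longrightarrow> spec (x ^ n) (y ^ n)"
  by (induction n) (simp_all add: spec_1 spec_mult)

lemma spec_sum: "(\<And>i. i \<in> A \<Longrightarrow> spec (x i) (y i)) \<Longrightarrow> spec (sum x A) (sum y A)"
  by (induction A rule: infinite_finite_induct) (simp_all add: spec_0 spec_add)

lemma spec_prod: "(\<And>i. i \<in> A \<Longrightarrow> spec (x i) (y i)) \<Longrightarrow> spec (prod x A) (prod y A)"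
  by (induction A rule: infinite_finite_induct) (simp_all add: spec_1 spec_mult)

lemma spec_qpoch: "spec x y \<Longrightarrow> spec p p' \<Longrightarrow> spec (qpoch x p k) (qpoch y p' k)"
  unfolding qpoch_def by (intro spec_prod spec_diff spec_1 spec_mult spec_power)

lemma spec_qpochs:
  "list_all2 spec xs ys \<Longrightarrow> spec p p' \<Longrightarrow> spec (qpochs xs p k) (qpochs ys p' k)"
  by (induction rule: list_all2_induct) (simp_all add: qpochs_def spec_1 spec_mult spec_qpoch)

lemma spec_qint:
  assumes "spec q q'" "q' \<noteq> 0" "q' \<noteq> 1"
  shows "spec (qint q m) (qint q' m)"
proof -
  have "spec (q powi m) (q' powi m)"
    using assms spec_divide[OF spec_1 assms(1)]
    by (cases "m \<ge> 0") (auto simp: power_int_def inverse_eq_divide intro!: spec_power)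
  then show ?thesis unfolding qint_def using assms by (intro spec_divide spec_diff spec_1) auto
qed

lemma spec_lhs_term:
  assumes "spec q q'" "spec a a'" "spec b b'" "spec c c'" "spec d d'"
    and "q' \<noteq> 0" "q' \<noteq> 1" "a' \<noteq> 0" "b' \<noteq> 0" "c' \<noteq> 0" "d' \<noteq> 0"
    and "qpochs [q'^2 / a', a' * q'^2, b' * q'^2, q'^2 / c', q'^2 / d', q'^2] (q'^2) k \<noteq> 0"
  shows "spec (lhs_term q a b c d k) (lhs_term q' a' b' c' d' k)"
  unfolding lhs_term_def using assms
  by (intro spec_mult spec_divide spec_qint spec_qpochs spec_power list_all2_Cons[THEN iffD2] conjI
        list_all2_Nil[THEN iffD2] TrueI spec_1) auto

lemma spec_rhs_term:
  assumes "spec q q'" "spec a a'" "spec b b'" "spec c c'" "spec d d'"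
    and "q' \<noteq> 0" "a' \<noteq> 0" "b' \<noteq> 0" "c' \<noteq> 0" "d' \<noteq> 0"
    and "qpochs [q'^2, 1 / (q'^2 * b'), q'^2 / c', q'^2 / d'] (q'^2) k \<noteq> 0"
  shows "spec (rhs_term q a b c d k) (rhs_term q' a' b' c' d' k)"
  unfolding rhs_term_def using assms
  by (intro spec_mult spec_divide spec_qpochs spec_power list_all2_Cons[THEN iffD2] conjI
        list_all2_Nil[THEN iffD2] TrueI spec_1) auto

lemma spec_rhs_factor:
  assumes "spec q q'" "spec b b'" and "q' \<noteq> 0" "q' \<noteq> 1" "b' \<noteq> 0"
    and "qpoch (b' * q'^2) (q'^2) ((n + 1) div 2) \<noteq> 0"
  shows "spec (rhs_factor q b n) (rhs_factor q' b' n)"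
  unfolding rhs_factor_def using assms
  by (intro spec_mult spec_divide spec_qint spec_qpoch spec_power spec_1) auto

text \<open>Coprimality makes \<open>D\<close> divide the denominator of any other representation,
  in particular one on which \<open>f\<close> does not vanish.\<close>

lemma spec_lowest_terms:
  assumes "spec (to_fract N / to_fract D) y" "coprime N D" "D \<noteq> 0"
  shows "f D \<noteq> 0" and "f N = y * f D"
proof -
  obtain N' D' where ND: "f D' \<noteq> 0" "to_fract D' \<noteq> 0"
    "to_fract N / to_fract D = to_fract N' / to_fract D'" "y = f N' / f D'"
    using assms(1) by (elim specE)
  have "to_fract (N * D') = to_fract (N' * D)"
    using ND assms(3) by (simp add: frac_eq_eq)
  then have e: "N * D' = N' * D" by (simp only: to_fract_eq_iff)
  then have "D dvd N * D'" by simp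
  then have "D dvd D'" using assms(2) by (simp add: coprime_dvd_mult_right_iff coprime_commute)
  then show "f D \<noteq> 0" using ND(1) hom_dvd[of D D'] by auto
  have "f N * f D' = f N' * f D" using arg_cong[OF e, of f] by (simp add: hom_mult)
  then show "f N = y * f D" unfolding ND(4) using ND(1) by (simp add: field_simps)
qed

end

section \<open>Specializing q and a under the indeterminates b, c, d\<close>

abbreviation const3 :: "'k::comm_ring_1 \<Rightarrow> 'k poly poly poly" where
  "const3 k \<equiv> [:[:[:k:]:]:]"

abbreviation map3 :: "('k::comm_ring_1 \<Rightarrow> 'l::comm_ring_1) \<Rightarrow> 'k poly poly poly \<Rightarrow> 'l poly poly poly" where
  "map3 g \<equiv> map_poly (map_poly (map_poly g))"

definition cst :: "'k::idom \<Rightarrow> 'k poly poly poly fract" where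
  "cst k = to_fract (const3 k)"

lemma cst_eq_iff [simp]: "cst u = cst v \<longleftrightarrow> u = v"
  by (simp add: cst_def)

lemma cst_0 [simp]: "cst 0 = 0" and cst_1 [simp]: "cst 1 = 1"
  by (simp_all add: cst_def flip: one_pCons)

lemma cst_eq_0_iff [simp]: "cst u = 0 \<longleftrightarrow> u = 0" and cst_eq_1_iff [simp]: "cst u = 1 \<longleftrightarrow> u = 1"
  using cst_eq_iff[of u 0] cst_eq_iff[of u 1] by simp_all

lemma cst_mult: "cst (u * v) = cst u * cst v"
  by (simp add: cst_def flip: to_fract_mult)

lemma cst_power: "cst (u ^ i) = cst u ^ i"
  by (induction i) (simp_all add: cst_mult)

text \<open>The left-hand sides have degree one in a variable. This supplies the nonvanishing of
  every denominator factor that contains \<open>b\<close>, \<open>c\<close> or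
  \<open>d\<close>.\<close>

lemma variables_times_cst_neq_cst:
  assumes "u \<noteq> 0"
  shows "to_fract [:[:[:0, 1:]:]:] * cst u \<noteq> cst v" "to_fract [:[:0, 1:]:] * cst u \<noteq> cst v"
    "to_fract [:0, 1:] * cst u \<noteq> cst v"
  using assms by (simp_all add: cst_def flip: to_fract_mult)

lemma const3_dvd_iff: "const3 (P :: 'k::idom) dvd N \<longleftrightarrow> (\<forall>i j k. P dvd coeff (coeff (coeff N i) j) k)"
  by (simp add: const_poly_dvd_iff)

lemma map3_eq_0_imp:
  assumes "g 0 = 0" "map3 g N = 0"
  shows "g (coeff (coeff (coeff N i) j) k) = 0"
proof -
  have "coeff (coeff (coeff (map3 g N) i) j) k = 0" by (simp add: assms)
  then show ?thesis by (simp add: coeff_map_poly assms(1))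
qed

text \<open>Only \<open>q\<close> and \<open>a\<close> are evaluated; \<open>b, c, d\<close> stay indeterminates over the target ring, so the
  denominators that involve them cannot vanish.\<close>

lemma lifted_specialization:
  fixes f :: "int poly poly \<Rightarrow> 'k::idom" and n M :: nat
  defines "\<kappa> \<equiv> f [:[:0, 1:]:]" and "\<alpha> \<equiv> f [:0, 1:]"
  defines "h \<equiv> (n + 1) div 2"
  assumes f: "unital_ring_hom f" and "n > 1" "M < n"
    and \<kappa>: "\<kappa> \<noteq> 0" "\<kappa> \<noteq> 1" and \<alpha>: "\<alpha> \<noteq> 0"
    and \<kappa>j: "\<And>j. 0 < j \<Longrightarrow> j < n \<Longrightarrow> \<kappa> ^ (2 * j) \<noteq> 1 \<and> \<kappa> ^ (2 * j) \<noteq> \<alpha> \<and> \<alpha> * \<kappa> ^ (2 * j) \<noteq> 1"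
    and eq: "\<And>b c d. b = to_fract [:[:[:0, 1:]:]:] \<Longrightarrow> c = to_fract [:[:0, 1:]:] \<Longrightarrow> d = to_fract [:0, 1:]
      \<Longrightarrow> (\<Sum>k\<le>M. lhs_term (cst \<kappa>) (cst \<alpha>) b c d k)
        = rhs_factor (cst \<kappa>) b n * (\<Sum>k\<le>h. rhs_term (cst \<kappa>) (cst \<alpha>) b c d k)"
    and ND: "to_fract N / to_fract D
      = (\<Sum>k\<le>M. lhs_term (to_fract Xq) (to_fract Xa) (to_fract Xb) (to_fract Xc) (to_fract Xd) k)
       - rhs_factor (to_fract Xq) (to_fract Xb) n
         * (\<Sum>k\<le>h. rhs_term (to_fract Xq) (to_fract Xa) (to_fract Xb) (to_fract Xc) (to_fract Xd) k)"
    and "coprime N D" "D \<noteq> 0"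
  shows "map3 f D \<noteq> 0 \<and> map3 f N = 0"
proof -
  interpret f: unital_ring_hom f by (rule f)
  interpret f1: unital_ring_hom "map_poly f" by (rule f.unital_ring_hom_map_poly)
  interpret f2: unital_ring_hom "map_poly (map_poly f)" by (rule f1.unital_ring_hom_map_poly)
  interpret f3: unital_ring_hom "map3 f" by (rule f2.unital_ring_hom_map_poly)
  \<comment> \<open>The values are embedded into a fraction field, since specialization asks for a
    field as target.\<close>
  define \<phi> where "\<phi> = (\<lambda>N. to_fract (map3 f N))"
  interpret \<phi>: specialization \<phi>
    unfolding \<phi>_def specialization_def
    by (rule unital_ring_hom_compose[OF unital_ring_hom_to_fract f3.unital_ring_hom_axioms])
  define b c d :: "'k poly poly poly fract"
    where "b = to_fract [:[:[:0, 1:]:]:]" and "c = to_fract [:[:0, 1:]:]" and "d = to_fract [:0, 1:]"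
  have h: "h < n" using \<open>n > 1\<close> by (simp add: h_def)
  have spec: "\<phi>.spec (to_fract Xq) (cst \<kappa>)" "\<phi>.spec (to_fract Xa) (cst \<alpha>)" "\<phi>.spec (to_fract Xb) b"
     "\<phi>.spec (to_fract Xc) c" "\<phi>.spec (to_fract Xd) d"
    by (rule \<phi>.spec_to_fract, simp add: \<phi>_def cst_def b_def c_def d_def \<kappa>_def \<alpha>_def
        Xq_def Xa_def Xb_def Xc_def Xd_def map_poly_pCons)+
  have nz: "cst \<kappa> \<noteq> 0" "cst \<kappa> \<noteq> 1" "cst \<alpha> \<noteq> 0" "b \<noteq> 0" "c \<noteq> 0" "d \<noteq> 0"
    using \<kappa> \<alpha> by (simp_all add: b_def c_def d_def)
  have p: "(cst \<kappa>)^2 * ((cst \<kappa>)^2) ^ j = cst (\<kappa> ^ (2 * Suc j))" for j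
    unfolding power_mult power_Suc cst_mult cst_power by (rule refl)
  have gen: "b * cst (\<kappa> ^ i) \<noteq> cst v" "c * cst (\<kappa> ^ i) \<noteq> cst v" "d * cst (\<kappa> ^ i) \<noteq> cst v" for i v
    unfolding b_def c_def d_def by (intro variables_times_cst_neq_cst power_not_zero \<kappa>)+
  \<comment> \<open>All summation indices are below \<open>n\<close>, so the factors free of
    \<open>b, c, d\<close> involve only the powers \<open>\<kappa> ^ (2 * Suc j)\<close> with
    \<open>Suc j < n\<close>, which \<open>\<kappa>j\<close> covers.\<close>
  have den: "qpoch ((cst \<kappa>)^2) ((cst \<kappa>)^2) k \<noteq> 0"
    "qpoch ((cst \<kappa>)^2 / cst \<alpha>) ((cst \<kappa>)^2) k \<noteq> 0"
    "qpoch (cst \<alpha> * (cst \<kappa>)^2) ((cst \<kappa>)^2) k \<noteq> 0"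
    "qpoch (b * (cst \<kappa>)^2) ((cst \<kappa>)^2) k \<noteq> 0"
    "qpoch ((cst \<kappa>)^2 / c) ((cst \<kappa>)^2) k \<noteq> 0"
    "qpoch ((cst \<kappa>)^2 / d) ((cst \<kappa>)^2) k \<noteq> 0"
    "qpoch (1 / ((cst \<kappa>)^2 * b)) ((cst \<kappa>)^2) k \<noteq> 0" if "k < n" for k
  proof -
    have gt: "(cst \<kappa>)^2 * ((cst \<kappa>)^2) ^ j \<noteq> 1"
      "(cst \<kappa>)^2 / cst \<alpha> * ((cst \<kappa>)^2) ^ j \<noteq> 1"
      "cst \<alpha> * (cst \<kappa>)^2 * ((cst \<kappa>)^2) ^ j \<noteq> 1"
      "b * (cst \<kappa>)^2 * ((cst \<kappa>)^2) ^ j \<noteq> 1"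
      "(cst \<kappa>)^2 / c * ((cst \<kappa>)^2) ^ j \<noteq> 1"
      "(cst \<kappa>)^2 / d * ((cst \<kappa>)^2) ^ j \<noteq> 1"
      "1 / ((cst \<kappa>)^2 * b) * ((cst \<kappa>)^2) ^ j \<noteq> 1" if "j < k" for j
    proof -
      define Q where "Q = \<kappa> ^ (2 * Suc j)"
      have Q: "Q \<noteq> 1" "Q \<noteq> \<alpha>" "\<alpha> * Q \<noteq> 1"
        using \<kappa>j[of "Suc j"] \<open>j < k\<close> \<open>k < n\<close> by (auto simp: Q_def)
      have swap: "(cst \<kappa>)^2 / x * ((cst \<kappa>)^2) ^ j = cst Q / x" for x
        unfolding Q_def p[symmetric] by simp
      show "(cst \<kappa>)^2 * ((cst \<kappa>)^2) ^ j \<noteq> 1"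
        unfolding p Q_def[symmetric] using Q by simp
      show "(cst \<kappa>)^2 / cst \<alpha> * ((cst \<kappa>)^2) ^ j \<noteq> 1"
        unfolding swap using Q nz by simp
      show "cst \<alpha> * (cst \<kappa>)^2 * ((cst \<kappa>)^2) ^ j \<noteq> 1"
        unfolding mult.assoc p Q_def[symmetric] cst_mult[symmetric] using Q by simp
      show "b * (cst \<kappa>)^2 * ((cst \<kappa>)^2) ^ j \<noteq> 1"
        unfolding mult.assoc p using gen(1)[of "2 * Suc j" 1] unfolding cst_1 .
      show "(cst \<kappa>)^2 / c * ((cst \<kappa>)^2) ^ j \<noteq> 1" "(cst \<kappa>)^2 / d * ((cst \<kappa>)^2) ^ j \<noteq> 1"
        unfolding swap using nz gen(2,3)[of 0 Q] by auto
      have "1 / ((cst \<kappa>)^2 * b) * ((cst \<kappa>)^2) ^ j = cst (\<kappa> ^ (2 * j)) / (b * cst (\<kappa>^2))"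
        unfolding cst_power power_mult by (simp add: mult.commute)
      then show "1 / ((cst \<kappa>)^2 * b) * ((cst \<kappa>)^2) ^ j \<noteq> 1"
        using gen(1)[of 2 "\<kappa> ^ (2 * j)"] by auto
    qed
    show "qpoch ((cst \<kappa>)^2) ((cst \<kappa>)^2) k \<noteq> 0"
      "qpoch ((cst \<kappa>)^2 / cst \<alpha>) ((cst \<kappa>)^2) k \<noteq> 0"
      "qpoch (cst \<alpha> * (cst \<kappa>)^2) ((cst \<kappa>)^2) k \<noteq> 0"
      "qpoch (b * (cst \<kappa>)^2) ((cst \<kappa>)^2) k \<noteq> 0"
      "qpoch ((cst \<kappa>)^2 / c) ((cst \<kappa>)^2) k \<noteq> 0"
      "qpoch ((cst \<kappa>)^2 / d) ((cst \<kappa>)^2) k \<noteq> 0"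
      "qpoch (1 / ((cst \<kappa>)^2 * b)) ((cst \<kappa>)^2) k \<noteq> 0"
      by (rule qpoch_nonzero, erule gt)+
  qed
  have "\<phi>.spec (\<Sum>k\<le>M. lhs_term (to_fract Xq) (to_fract Xa) (to_fract Xb) (to_fract Xc) (to_fract Xd) k)
      (\<Sum>k\<le>M. lhs_term (cst \<kappa>) (cst \<alpha>) b c d k)"
    using spec nz den \<open>M < n\<close> by (intro \<phi>.spec_sum \<phi>.spec_lhs_term) (auto simp: qpochs_def)
  moreover have "\<phi>.spec (rhs_factor (to_fract Xq) (to_fract Xb) n
        * (\<Sum>k\<le>h. rhs_term (to_fract Xq) (to_fract Xa) (to_fract Xb) (to_fract Xc) (to_fract Xd) k))
      (rhs_factor (cst \<kappa>) b n * (\<Sum>k\<le>h. rhs_term (cst \<kappa>) (cst \<alpha>) b c d k))"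
    using spec nz den h
    by (intro \<phi>.spec_mult \<phi>.spec_sum \<phi>.spec_rhs_term \<phi>.spec_rhs_factor) (auto simp: qpochs_def h_def)
  ultimately have "\<phi>.spec (to_fract N / to_fract D) 0"
    using \<phi>.spec_diff eq[OF b_def c_def d_def] unfolding ND by fastforce
  from \<phi>.spec_lowest_terms[OF this \<open>coprime N D\<close> \<open>D \<noteq> 0\<close>]
  show ?thesis by (simp_all add: \<phi>_def)
qed

lemma (in unital_ring_hom) unital_ring_hom_map3: "unital_ring_hom (map3 f)"
  by (intro unital_ring_hom.unital_ring_hom_map_poly unital_ring_hom_axioms)

lemma prime_elem_const3_iff: "prime_elem (const3 (P :: 'k::idom)) \<longleftrightarrow> prime_elem P"
  by (simp add: prime_elem_const_poly_iff)

text \<open>A prime element is coprime to everything it does not divide, and \<open>g\<close> kills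
  \<open>P\<close> but not \<open>D\<close>.\<close>

lemma coprime_const3I:
  fixes g :: "int poly poly \<Rightarrow> 'k::idom"
  assumes "unital_ring_hom g" "prime_elem P" "g P = 0" "map3 g D \<noteq> 0"
  shows "coprime D (const3 P)"
proof -
  interpret unital_ring_hom g by (rule assms(1))
  interpret g3: unital_ring_hom "map3 g" by (rule unital_ring_hom_map3)
  have "\<not> const3 P dvd D"
  proof
    assume "const3 P dvd D"
    then have "map3 g (const3 P) dvd map3 g D" by (rule g3.hom_dvd)
    then show False using assms(3,4) by (simp add: map_poly_pCons)
  qed
  then show ?thesis
    using prime_elem_imp_coprime[of "const3 P" D] assms(2)
    by (simp add: prime_elem_const3_iff coprime_commute)
qed

lemma const_poly_divisorE:
  fixes g :: "'a::idom poly"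
  assumes "g dvd [:c:]" "c \<noteq> 0"
  obtains g' where "g = [:g':]" "g' dvd c"
proof -
  have "degree g = 0" using dvd_imp_degree_le[OF assms(1)] assms(2) by simp
  then obtain g' where "g = [:g':]" by (rule degree_eq_zeroE)
  then show ?thesis using that assms(1) by simp
qed

section \<open>The evaluations at a = q^n, at a = q^(-n) and at roots of unity\<close>

definition at_a_power :: "nat \<Rightarrow> int poly poly \<Rightarrow> int poly" where
  "at_a_power n p = poly p ([:0, 1:] ^ n)"

text \<open>The negative power of \<open>q\<close> makes the fraction field of the polynomials in
  \<open>q\<close> the target.\<close>

definition at_a_inverse_power :: "nat \<Rightarrow> int poly poly \<Rightarrow> int poly fract" where
  "at_a_inverse_power n p = poly (fract_poly p) (1 / to_fract [:0, 1:] ^ n)"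

text \<open>The inner variable is \<open>q\<close>, so it is evaluated coefficientwise and
  \<open>a\<close> stays an indeterminate.\<close>

definition at_q_root :: "complex \<Rightarrow> int poly poly \<Rightarrow> complex poly" where
  "at_q_root z = map_poly (\<lambda>p. poly (complex_poly p) z)"

lemma unital_ring_hom_at_a_power: "unital_ring_hom (at_a_power n)"
  unfolding at_a_power_def by (rule unital_ring_hom_poly)

lemma unital_ring_hom_at_a_inverse_power: "unital_ring_hom (at_a_inverse_power n)"
  unfolding at_a_inverse_power_def
  by (intro unital_ring_hom_compose[OF unital_ring_hom_poly]
      unital_ring_hom.unital_ring_hom_map_poly unital_ring_hom_to_fract)

lemma unital_ring_hom_at_q_root: "unital_ring_hom (at_q_root z)"
  unfolding at_q_root_def
  by (intro unital_ring_hom.unital_ring_hom_map_poly unital_ring_hom_compose[OF unital_ring_hom_poly]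
      complex_poly.unital_ring_hom_axioms)

lemma at_a_power_eq_0_imp_dvd: "at_a_power n p = 0 \<Longrightarrow> [:- ([:0, 1:] ^ n), 1:] dvd p"
  by (simp add: at_a_power_def poly_eq_0_iff_dvd)

text \<open>Gauss's lemma: the root gives a linear factor over the fraction field, and since
  \<open>1 - q^n a\<close> has content 1, the divisibility descends.\<close>

lemma at_a_inverse_power_eq_0_imp_dvd:
  assumes "at_a_inverse_power n p = 0"
  shows "[:1, - ([:0, 1:] ^ n):] dvd p"
proof (rule fract_poly_dvdD)
  define r :: "int poly" where "r = [:0, 1:] ^ n"
  have r: "to_fract r \<noteq> 0" by (simp add: r_def)
  have tr: "to_fract [:0, 1:] ^ n = to_fract r"
    unfolding r_def by (rule unital_ring_hom.hom_power[OF unital_ring_hom_to_fract, symmetric])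
  have "[:- (1 / to_fract r), 1:] dvd fract_poly p"
    using assms by (simp add: at_a_inverse_power_def poly_eq_0_iff_dvd tr)
  \<comment> \<open>Scaling by \<open>- q^n\<close> clears the denominator of
    \<open>a - q^(-n)\<close>.\<close>
  then have "smult (- to_fract r) [:- (1 / to_fract r), 1:] dvd fract_poly p"
    by (rule smult_dvd) (use r in simp)
  also have "smult (- to_fract r) [:- (1 / to_fract r), 1:] = fract_poly [:1, - r:]"
    using r by (simp add: map_poly_pCons)
  finally show "fract_poly [:1, - ([:0, 1:] ^ n):] dvd fract_poly p" by (simp add: r_def)
  show "content [:1, - ([:0, 1:] ^ n) :: int poly:] = 1" by (simp add: content_def)
qed

lemma at_q_root_eq_0_imp_dvd:
  assumes "n > 0" "\<And>z. z \<in> primitive_roots n \<Longrightarrow> at_q_root z p = 0"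
  shows "[:cyclotomic n:] dvd p"
  unfolding const_poly_dvd_iff
proof
  fix i show "cyclotomic n dvd coeff p i"
  proof (rule cyclotomic_dvdI[OF assms(1)])
    fix z assume "z \<in> primitive_roots n"
    then have "coeff (at_q_root z p) i = 0" using assms(2) by simp
    then show "poly (complex_poly (coeff p i)) z = 0" by (simp add: at_q_root_def coeff_map_poly)
  qed
qed

text \<open>A common divisor is a polynomial in \<open>q\<close> alone. If it is constant, it
  divides the leading coefficient 1; otherwise it has a complex root, which is a primitive root of
  unity at which \<open>D\<close> would vanish.\<close>

lemma coprime_cyclotomicI:
  assumes "n > 0" "\<And>z. z \<in> primitive_roots n \<Longrightarrow> map3 (at_q_root z) D \<noteq> 0"
  shows "coprime D (const3 [:cyclotomic n:])"
proof (rule coprimeI)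
  fix g assume gD: "g dvd D" and g: "g dvd const3 [:cyclotomic n:]"
  have c0: "cyclotomic n \<noteq> 0" using lead_coeff_cyclotomic[OF assms(1)] by auto
  obtain g' where g': "g = const3 [:g':]" "g' dvd cyclotomic n"
    using g c0 by (auto elim!: const_poly_divisorE)
  show "is_unit g"
  proof (cases "degree g' = 0")
    case True
    then obtain i where i: "g' = [:i:]" by (rule degree_eq_zeroE)
    then have "i dvd lead_coeff (cyclotomic n)" using g'(2) by (simp add: const_poly_dvd_iff)
    then have "i dvd 1" using lead_coeff_cyclotomic[OF assms(1)] by simp
    then show ?thesis by (simp add: g' i is_unit_const_poly_iff)
  next
    case False
    then have "\<not> constant (poly (complex_poly g'))" by (simp add: constant_degree)
    then obtain z where z: "poly (complex_poly g') z = 0" by (metis fundamental_theorem_of_algebra)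
    have "complex_poly g' dvd complex_poly (cyclotomic n)" using g'(2) by (rule complex_poly.hom_dvd)
    then have "poly (complex_poly (cyclotomic n)) z = 0" using z by (auto elim!: dvdE)
    then have zp: "z \<in> primitive_roots n" using poly_cyclotomic_eq_0_iff[OF assms(1)] by blast
    interpret unital_ring_hom "map3 (at_q_root z)"
      by (intro unital_ring_hom.unital_ring_hom_map3 unital_ring_hom_at_q_root)
    have "map3 (at_q_root z) g dvd map3 (at_q_root z) D" using gD by (rule hom_dvd)
    moreover have "map3 (at_q_root z) g = 0"
      using z unfolding g' by (simp add: map_poly_pCons at_q_root_def)
    ultimately show ?thesis using assms(2)[OF zp] by simp
  qed
qed

text \<open>Puts the cyclotomic factor into the form in which divisibility and coprimality are
  tested on coefficients.\<close>

lemma Phi_eq_const3: "Phi n = const3 [:cyclotomic n:]"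
proof -
  interpret h: unital_ring_hom "\<lambda>p :: int poly. const3 [:p:]"
    by (intro unital_ring_hom_compose[OF unital_ring_hom_const] unital_ring_hom_const)
  have "cyclotomic n = (\<Sum>i\<le>degree (cyclotomic n). of_int (coeff (cyclotomic n) i) * [:0, 1:] ^ i)"
    by (subst poly_as_sum_of_monoms[of "cyclotomic n", symmetric])
      (simp add: monom_altdef of_int_poly)
  then have "const3 [:cyclotomic n:]
    = const3 [:\<Sum>i\<le>degree (cyclotomic n). of_int (coeff (cyclotomic n) i) * [:0, 1:] ^ i:]"
    by simp
  also have "\<dots> = Phi n"
    unfolding h.hom_sum h.hom_mult h.hom_power h.hom_of_int Phi_def eval_at_q_def Xq_def by (rule refl)
  finally show ?thesis by simp
qed

section \<open>The congruence\<close>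

lemma X_power_eq_iff [simp]: "([:0, 1:] :: int poly) ^ i = [:0, 1:] ^ j \<longleftrightarrow> i = j"
  by (metis degree_linear_power)

lemma X_power_eq_1_iff [simp]: "([:0, 1:] :: int poly) ^ i = 1 \<longleftrightarrow> i = 0"
  using X_power_eq_iff[of i 0] by simp

text \<open>Used twice: with \<open>\<kappa>\<close> the variable \<open>q\<close> among the integer
  polynomials, and with \<open>\<kappa>\<close> its image in their fraction field.\<close>

lemma sum_lhs_term_cst_at_power:
  fixes \<kappa> :: "'k::idom"
  assumes "odd n" "(n + 1) div 2 \<le> M"
    and \<kappa>: "\<kappa> \<noteq> 0" and inj: "\<And>i j. \<kappa> ^ i = \<kappa> ^ j \<Longrightarrow> i = j"
    and "b = to_fract [:[:[:0, 1:]:]:]" "c = to_fract [:[:0, 1:]:]" "d = to_fract [:0, 1:]"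
  shows "(\<Sum>k\<le>M. lhs_term (cst \<kappa>) (cst \<kappa> ^ n) b c d k)
    = rhs_factor (cst \<kappa>) b n * (\<Sum>k\<le>(n + 1) div 2. rhs_term (cst \<kappa>) (cst \<kappa> ^ n) b c d k)"
  using assms
proof (intro sum_lhs_term_at_power)
  fix i j
  show "i = j" if "cst \<kappa> ^ i = cst \<kappa> ^ j" using that inj by (simp flip: cst_power)
  show "b * cst \<kappa> ^ i \<noteq> cst \<kappa> ^ j" "c * cst \<kappa> ^ i \<noteq> cst \<kappa> ^ j" "d * cst \<kappa> ^ i \<noteq> cst \<kappa> ^ j"
    unfolding assms cst_power[symmetric] by (intro variables_times_cst_neq_cst power_not_zero \<kappa>)+
qed simp_all

lemma sum_lhs_term_cst_root_of_unity:
  fixes z :: complex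
  assumes "odd n" "n > 1" "M = (n + 1) div 2 \<or> M = n - 1" and z: "z \<in> primitive_roots n"
    and bcd: "b = to_fract [:[:[:0, 1:]:]:]" "c = to_fract [:[:0, 1:]:]" "d = to_fract [:0, 1:]"
  shows "(\<Sum>k\<le>M. lhs_term (cst [:z:]) (cst [:0, 1:]) b c d k) = 0"
proof (rule sum_lhs_term_root_of_unity[OF assms(1,3)])
  have zn: "z ^ n = 1" and zj: "\<And>j. 0 < j \<Longrightarrow> j < n \<Longrightarrow> z ^ j \<noteq> 1"
    using z by (auto simp: primitive_roots_def)
  have z0: "z \<noteq> 0" using zn assms(2) by (auto simp: power_0_left)
  have p: "cst [:z:] ^ j = cst [:z ^ j:]" for j
    by (simp add: cst_power[symmetric] poly_const_pow)
  show "cst [:z:] ^ n = 1" unfolding p by (simp add: zn flip: one_pCons)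
  show "cst [:z:] ^ j \<noteq> 1" if "0 < j" "j < n" for j
    unfolding p using zj[OF that] by (simp add: one_pCons)
  \<comment> \<open>Characteristic zero is passed on from the polynomials to their fraction
    field.\<close>
  have "(2 :: complex poly poly poly poly fract) = to_fract 2"
    by (metis one_add_one to_fract_1 to_fract_add)
  moreover have "to_fract (2 :: complex poly poly poly poly) \<noteq> 0"
    unfolding to_fract_eq_0_iff by simp
  ultimately show "(2 :: complex poly poly poly poly fract) \<noteq> 0" by metis
  show "cst [:0, 1:] \<noteq> 0" "b \<noteq> 0" "c \<noteq> 0" "d \<noteq> 0" by (simp_all add: bcd)
  fix x :: "complex poly poly poly poly fract" and j
  assume x: "x \<in> {cst [:0, 1:], 1 / cst [:0, 1:], 1 / b, c, d}"
  have zj0: "[:z ^ j:] \<noteq> 0" using z0 by simp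
  have inv: "1 / y \<noteq> cst [:z ^ j:]" if "y * cst [:z ^ j:] \<noteq> cst 1" "y \<noteq> 0" for y
    using that by (auto simp: field_simps)
  have "cst [:0, 1:] \<noteq> cst [:z ^ j:]" by simp
  moreover have "1 / cst [:0, 1:] \<noteq> cst [:z ^ j:]"
    by (rule inv) (use z0 in \<open>simp_all add: one_pCons flip: cst_mult\<close>)
  moreover have "1 / b \<noteq> cst [:z ^ j:]"
  proof (rule inv)
    show "b * cst [:z ^ j:] \<noteq> cst 1"
      unfolding bcd by (rule variables_times_cst_neq_cst(1)[OF zj0])
  qed (simp add: bcd)
  moreover have "c \<noteq> cst [:z ^ j:]" "d \<noteq> cst [:z ^ j:]"
    using variables_times_cst_neq_cst(2,3)[of "1 :: complex poly" "[:z ^ j:]"] by (simp_all add: bcd)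
  ultimately show "x \<noteq> cst [:z:] ^ j" unfolding p using x by (metis insertE empty_iff)
qed (use assms in auto)

lemma divides_mult3:
  fixes P Q R N :: "'a::semiring_gcd"
  assumes "P dvd N" "Q dvd N" "R dvd N" "coprime Q P" "coprime R P" "coprime Q R"
  shows "P * Q * R dvd N"
  using assms by (intro divides_mult) (simp_all add: coprime_commute)

lemma coprime_mult3:
  fixes P Q R D :: "'a::semiring_gcd"
  assumes "coprime D P" "coprime D Q" "coprime D R"
  shows "coprime D (P * Q * R)"
  using assms by simp

theorem theorem1p1:
  fixes n M :: nat
  assumes "odd n" and "n > 1" and "M = (n + 1) div 2 \<or> M = n - 1"
  shows "let q = to_fract Xq; a = to_fract Xa; b = to_fract Xb; c = to_fract Xc;
             d = to_fract Xd; h = (n + 1) div 2 in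
    cong_rf
      (\<Sum>k\<le>M. qint q (4 * int k - 1)
         * qpochs [a / q, 1 / (a * q), 1 / (b * q), c / q, d / q, 1 / q] (q^2) k
         / qpochs [q^2 / a, a * q^2, b * q^2, q^2 / c, q^2 / d, q^2] (q^2) k
         * (b * q^7 / (c * d)) ^ k)
      (qint q (int n) * (b * q) ^ h * qpoch (1 / (q^2 * b)) (q^2) h / qpoch (b * q^2) (q^2) h
         * (\<Sum>k\<le>h. qpochs [a / q, 1 / (a * q), 1 / (b * q), q^3 / (c * d)] (q^2) k
              / qpochs [q^2, 1 / (q^2 * b), q^2 / c, q^2 / d] (q^2) k * q ^ (2 * k)))
      (Phi n * (1 - Xa * Xq ^ n) * (Xa - Xq ^ n))"
proof -
  define A where "A = (\<Sum>k\<le>M. lhs_term (to_fract Xq) (to_fract Xa) (to_fract Xb) (to_fract Xc) (to_fract Xd) k)"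
  define B where "B = rhs_factor (to_fract Xq) (to_fract Xb) n
    * (\<Sum>k\<le>(n + 1) div 2. rhs_term (to_fract Xq) (to_fract Xa) (to_fract Xb) (to_fract Xc) (to_fract Xd) k)"
  define N D where "N = fst (quot_of_fract (A - B))" and "D = snd (quot_of_fract (A - B))"
  have ND: "to_fract N / to_fract D = A - B" "coprime N D" "D \<noteq> 0"
    by (simp_all add: N_def D_def coprime_quot_of_fract flip: Fract_conv_to_fract)
  define r :: "int poly" where "r = [:0, 1:] ^ n"
  have Mn: "M < n" and hM: "(n + 1) div 2 \<le> M" and n0: "n > 0"
    using assms by (auto elim!: oddE)
  have r0: "r \<noteq> 0" by (simp add: r_def)
  \<comment> \<open>Keeps the denominator factors \<open>1 - q^(2 j) / a\<close> from vanishing at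
    \<open>a = q^n\<close>, and \<open>1 - a q^(2 j)\<close> at \<open>a = q^(-n)\<close>.\<close>
  have par: "2 * j \<noteq> n" for j using assms(1) by auto

  have 1: "map3 (at_a_power n) D \<noteq> 0 \<and> map3 (at_a_power n) N = 0"
  proof -
    have v: "at_a_power n [:[:0, 1:]:] = [:0, 1:]" "at_a_power n [:0, 1:] = r"
      by (simp_all add: at_a_power_def r_def)
    show ?thesis
    proof (rule lifted_specialization[OF unital_ring_hom_at_a_power[of n] assms(2) Mn
          _ _ _ _ _ ND(1)[unfolded A_def B_def] ND(2,3), unfolded v])
      fix b c d :: "int poly poly poly poly fract"
      assume bcd: "b = to_fract [:[:[:0, 1:]:]:]" "c = to_fract [:[:0, 1:]:]" "d = to_fract [:0, 1:]"
      show "(\<Sum>k\<le>M. lhs_term (cst [:0, 1:]) (cst r) b c d k)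
        = rhs_factor (cst [:0, 1:]) b n * (\<Sum>k\<le>(n + 1) div 2. rhs_term (cst [:0, 1:]) (cst r) b c d k)"
        unfolding r_def cst_power
        by (rule sum_lhs_term_cst_at_power[OF assms(1) hM _ _ bcd]) simp_all
    qed (use r0 par X_power_eq_1_iff[of 1] in \<open>auto simp: r_def simp flip: power_add\<close>)
  qed

  have 2: "map3 (at_a_inverse_power n) D \<noteq> 0 \<and> map3 (at_a_inverse_power n) N = 0"
  proof -
    define \<kappa> where "\<kappa> = to_fract [:0, 1 :: int:]"
    have \<kappa>p: "\<kappa> ^ i = to_fract ([:0, 1:] ^ i)" for i
      unfolding \<kappa>_def by (rule unital_ring_hom.hom_power[OF unital_ring_hom_to_fract, symmetric])
    have \<kappa>: "\<kappa> \<noteq> 0" and \<kappa>_inj: "\<kappa> ^ i = \<kappa> ^ j \<longleftrightarrow> i = j" for i j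
      unfolding \<kappa>p by (simp_all add: \<kappa>_def)
    have \<kappa>1: "\<kappa> ^ i = 1 \<longleftrightarrow> i = 0" for i using \<kappa>_inj[of i 0] by simp
    have v: "at_a_inverse_power n [:[:0, 1:]:] = \<kappa>" "at_a_inverse_power n [:0, 1:] = 1 / \<kappa> ^ n"
      by (simp_all add: at_a_inverse_power_def \<kappa>_def map_poly_pCons)
    have c: "cst (1 / \<kappa> ^ n) = 1 / cst \<kappa> ^ n"
    proof -
      have "cst (1 / \<kappa> ^ n) * cst \<kappa> ^ n = 1"
        unfolding cst_power[symmetric] cst_mult[symmetric] using \<kappa> by simp
      then show ?thesis using \<kappa> by (simp add: field_simps)
    qed
    show ?thesis
    proof (rule lifted_specialization[OF unital_ring_hom_at_a_inverse_power[of n] assms(2) Mn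
          _ _ _ _ _ ND(1)[unfolded A_def B_def] ND(2,3), unfolded v])
      fix b c d :: "int poly fract poly poly poly fract"
      assume bcd: "b = to_fract [:[:[:0, 1:]:]:]" "c = to_fract [:[:0, 1:]:]" "d = to_fract [:0, 1:]"
      show "(\<Sum>k\<le>M. lhs_term (cst \<kappa>) (cst (1 / \<kappa> ^ n)) b c d k)
        = rhs_factor (cst \<kappa>) b n * (\<Sum>k\<le>(n + 1) div 2. rhs_term (cst \<kappa>) (cst (1 / \<kappa> ^ n)) b c d k)"
        \<comment> \<open>Both summands are invariant under \<open>a -> 1 / a\<close>, so the
          identity at \<open>a = q^n\<close> applies.\<close>
        unfolding c lhs_term_inverse rhs_term_inverse
        by (rule sum_lhs_term_cst_at_power[OF assms(1) hM _ _ bcd]) (simp_all add: \<kappa> \<kappa>_inj)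
    next
      fix j :: nat assume "0 < j" "j < n"
      show "\<kappa> ^ (2 * j) \<noteq> 1 \<and> \<kappa> ^ (2 * j) \<noteq> 1 / \<kappa> ^ n \<and> 1 / \<kappa> ^ n * \<kappa> ^ (2 * j) \<noteq> 1"
        using \<open>0 < j\<close> \<kappa> par[of j] \<kappa>1[of "2 * j"] \<kappa>1[of "2 * j + n"] \<kappa>_inj[of "2 * j" n]
        by (auto simp: field_simps power_add)
    qed (use \<kappa> \<kappa>1[of 1] in auto)
  qed

  have 3: "map3 (at_q_root z) D \<noteq> 0 \<and> map3 (at_q_root z) N = 0" if z: "z \<in> primitive_roots n" for z
  proof -
    have v: "at_q_root z [:[:0, 1:]:] = [:z:]" "at_q_root z [:0, 1:] = [:0, 1:]"
      by (simp_all add: at_q_root_def map_poly_pCons)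
    have zn: "z ^ n = 1" using z by (simp add: primitive_roots_def)
    have z0: "z \<noteq> 0" using zn n0 by (auto simp: power_0_left)
    have z1: "z \<noteq> 1" using primitive_roots_power_eq_1_iff[OF z n0, of 1] assms(2) by auto
    show ?thesis
    proof (rule lifted_specialization[OF unital_ring_hom_at_q_root[of z] assms(2) Mn
          _ _ _ _ _ ND(1)[unfolded A_def B_def] ND(2,3), unfolded v])
      fix b c d :: "complex poly poly poly poly fract"
      assume bcd: "b = to_fract [:[:[:0, 1:]:]:]" "c = to_fract [:[:0, 1:]:]" "d = to_fract [:0, 1:]"
      have "cst [:z:] ^ n = 1"
        by (simp add: cst_power[symmetric] poly_const_pow zn flip: one_pCons)
      then have "rhs_factor (cst [:z:]) b n = 0" by (simp add: rhs_factor_def qint_def)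
      then show "(\<Sum>k\<le>M. lhs_term (cst [:z:]) (cst [:0, 1:]) b c d k)
        = rhs_factor (cst [:z:]) b n * (\<Sum>k\<le>(n + 1) div 2. rhs_term (cst [:z:]) (cst [:0, 1:]) b c d k)"
        using sum_lhs_term_cst_root_of_unity[OF assms z bcd] by simp
    next
      fix j :: nat assume j: "0 < j" "j < n"
      \<comment> \<open>As \<open>n\<close> is odd, it would have to divide \<open>j\<close>, which
        is smaller.\<close>
      have "\<not> n dvd 2 * j"
        using j assms(1) by (auto simp: coprime_dvd_mult_right_iff dest!: dvd_imp_le)
      then have "z ^ (2 * j) \<noteq> 1" using primitive_roots_power_eq_1_iff[OF z n0] by blast
      then show "[:z:] ^ (2 * j) \<noteq> 1 \<and> [:z:] ^ (2 * j) \<noteq> [:0, 1:] \<and> [:0, 1:] * [:z:] ^ (2 * j) \<noteq> 1"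
        by (simp add: poly_const_pow one_pCons)
    qed (use z0 z1 in \<open>auto simp: one_pCons\<close>)
  qed

  interpret const3: unital_ring_hom "const3 :: int poly poly \<Rightarrow> mpoly"
    by (intro unital_ring_hom_compose[OF unital_ring_hom_const] unital_ring_hom_const)
  have X: "Xa = const3 [:0, 1:]" "Xq = const3 [:[:0, 1:]:]" by (simp_all add: Xa_def Xq_def)
  have P1: "Xa - Xq ^ n = const3 [:- r, 1:]"
    unfolding X const3.hom_power[symmetric] const3.hom_diff[symmetric] by (simp add: poly_const_pow r_def)
  have P2: "1 - Xa * Xq ^ n = const3 [:1, - r:]"
    unfolding X const3.hom_power[symmetric] const3.hom_mult[symmetric] const3.hom_one[symmetric]
      const3.hom_diff[symmetric]
    by (simp add: poly_const_pow r_def one_pCons)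
  \<comment> \<open>Each is linear in \<open>a\<close> and has 1 among its coefficients, hence is
    primitive.\<close>
  have prime: "prime_elem [:- r, 1:]" "prime_elem [:1, - r:]"
    using r0 by (auto intro!: prime_elem_linear_poly)
  have zero: "at_a_power n [:- r, 1:] = 0" "at_a_inverse_power n [:1, - r:] = 0"
    by (auto simp: at_a_power_def at_a_inverse_power_def r_def map_poly_pCons
        unital_ring_hom.hom_power[OF unital_ring_hom_to_fract])

  have "const3 [:- r, 1:] dvd N"
    unfolding const3_dvd_iff r_def
    using map3_eq_0_imp[OF _ 1[THEN conjunct2]]
    by (simp add: at_a_power_eq_0_imp_dvd unital_ring_hom.hom_zero[OF unital_ring_hom_at_a_power])
  moreover have "const3 [:1, - r:] dvd N"
    unfolding const3_dvd_iff r_def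
    using map3_eq_0_imp[OF _ 2[THEN conjunct2]]
    by (simp add: at_a_inverse_power_eq_0_imp_dvd
        unital_ring_hom.hom_zero[OF unital_ring_hom_at_a_inverse_power])
  moreover have "Phi n dvd N"
    unfolding Phi_eq_const3 const3_dvd_iff
    using map3_eq_0_imp[OF _ 3[THEN conjunct2]]
    by (simp add: at_q_root_eq_0_imp_dvd[OF n0] unital_ring_hom.hom_zero[OF unital_ring_hom_at_q_root])
  moreover have "coprime (const3 [:1, - r:]) (const3 [:- r, 1:])"
  proof (rule coprime_const3I[OF unital_ring_hom_at_a_power prime(1) zero(1)])
    \<comment> \<open>At \<open>a = q^n\<close> the factor \<open>1 - a q^n\<close> takes the value
      \<open>1 - q^(2 n)\<close>.\<close>
    have "r * r \<noteq> 1" using n0 by (simp add: r_def flip: power_add)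
    then show "map3 (at_a_power n) (const3 [:1, - r:]) \<noteq> 0"
      by (simp add: map_poly_pCons at_a_power_def r_def)
  qed
  \<comment> \<open>Evaluating \<open>q\<close> leaves the coefficient 1 of each linear factor in
    place, so neither vanishes at a root of unity.\<close>
  moreover have "coprime (const3 [:1, - r:]) (Phi n)" "coprime (const3 [:- r, 1:]) (Phi n)"
    unfolding Phi_eq_const3
    by (rule coprime_cyclotomicI[OF n0];
        auto simp: map_poly_pCons at_q_root_def r_def one_pCons)+
  moreover have "coprime D (const3 [:- r, 1:])"
    by (rule coprime_const3I[OF unital_ring_hom_at_a_power prime(1) zero(1) 1[THEN conjunct1]])
  moreover have "coprime D (const3 [:1, - r:])"
    by (rule coprime_const3I[OF unital_ring_hom_at_a_inverse_power prime(2) zero(2) 2[THEN conjunct1]])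
  moreover have "coprime D (Phi n)"
    unfolding Phi_eq_const3 by (rule coprime_cyclotomicI[OF n0 3[THEN conjunct1]])
  ultimately have "Phi n * (1 - Xa * Xq ^ n) * (Xa - Xq ^ n) dvd N
      \<and> coprime D (Phi n * (1 - Xa * Xq ^ n) * (Xa - Xq ^ n))"
    unfolding P1[symmetric] P2[symmetric] by - (intro conjI divides_mult3 coprime_mult3; assumption)
  then have "cong_rf A B (Phi n * (1 - Xa * Xq ^ n) * (Xa - Xq ^ n))"
    unfolding cong_rf_def using ND by metis
  then show ?thesis
    unfolding Let_def A_def B_def lhs_term_def rhs_term_def rhs_factor_def .
qed

end
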